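(* Let $\Gamma=(V,E,\ell,\mathcal{H}_\Gamma)$ be a compact connected $d$-regular simple quantum graph with $\delta$-type vertex conditions, where $\alpha_\upsilon<\infty$ for each $\upsilon\in V$. Let $\mathcal{H}_\Gamma$ be a Schrödinger-type differential operator with potential $W$, and let $\mathcal{T}$ be the universal cover of $\Gamma$, equipped with the corresponding Schrödinger operator $\mathcal{H}_{\mathcal{T}}$. Then for every $\lambda\in\sigma_{\mathfrak p}(\mathcal{H}_{\mathcal{T}})$ there exists an edge $e\in E$ such that the boundary value problem $$-f''(x)+W|_e(x)f(x)=\lambda f(x)\quad (x\in[0,\ell_e]),\qquad f(0)=f(\ell_e)=0$$ admits a nontrivial solution on $[0,\ell_e]$. In the case of the standard Schrödinger operator (i.e., when $W=0$), it follows that $$\sigma_{\mathfrak p}(\mathcal{H}_{\mathcal{T}})\subseteq\left\{\frac{n^2\pi^2}{\ell_e^2}\;\middle|\;e\in E,\ n\in\mathbb{N}\right\}.$$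
   Context: A metric graph $\Gamma=(V,E,\ell)$ is a simple (no loops, no multiple edges), locally finite graph with edge lengths $\ell_e>0$ bounded below by a positive constant; each edge $e$ is identified with the interval $[0,\ell_e]$, with endpoints glued at the vertices. It is compact if $V,E$ are finite. It is $d$-regular if every vertex has degree $d$. A quantum graph $\Gamma=(V,E,\ell,\mathcal{H}_\Gamma)$ with Schrödinger-type operator and $\delta$-type vertex conditions is given by a metric graph, a real potential $W$ which is continuous on each closed edge (values on different edges need not match at vertices), and constants $\alpha_\upsilon\in\mathbb{R}\cup\{\infty\}$, $\upsilon\in V$. The operator $\mathcal{H}_\Gamma$ acts in $\bigoplus_{e\in E}L^2(e)$ by $f\mapsto -f''+Wf$ on each edge, with domain the set of $f\in\bigoplus_{e\in E}H^2(e)$ (Hilbert direct sum) such that at every vertex $\upsilon$: $f$ is continuous at $\upsilon$, and if $\alpha_\upsilon<\infty$ the sum over the edges incident to $\upsilon$ of the derivatives of $f$ at $\upsilon$, taken in the direction outgoing from $\upsilon$, equals $\alpha_\upsilon f(\upsilon)$, while if $\alpha_\upsilon=\infty$ then $f(\upsilon)=0$ (Dirichlet). The universal cover $\mathcal{T}$ of $\Gamma$ is the tree which is the universal cover of the connected graph $\Gamma$ (so $\mathcal{T}=\Gamma$ if $\Gamma$ is a tree), with covering map $\Xi:\mathcal{T}\to\Gamma$, where edge lengths, potential and vertex constants are lifted through $\Xi$; $\mathcal{H}_{\mathcal{T}}$ is the resulting operator. $\sigma_{\mathfrak p}(\cdot)$ denotes the set of eigenvalues (with eigenfunctions in the domain).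 $\mathbb{N}=\{1,2,\dots\}$.
   Formalization: The formal theorem assumes d ≠ 1: for d = 1 the graph is a single edge equal to its universal cover, and with W = 0 and α = 0 the constant function has eigenvalue 0, which is not a Dirichlet eigenvalue. *)

theory Defs
  imports "HOL-Analysis.Analysis"
begin

section \<open>Metric graphs\<close>

text \<open>
  An edge of a simple graph is stored as one of its two orientations: the edge \<open>(u, v)\<close> is
  identified with the interval from \<open>0\<close> to its length so that \<open>0\<close> is glued to \<open>u\<close> and the
  other end to \<open>v\<close>.
\<close>

record 'v metric_graph =
  verts :: "'v set"
  edges :: "('v \<times> 'v) set"
  len :: "'v \<times> 'v \<Rightarrow> real"

definition adjacent :: "('v, 'x) metric_graph_scheme \<Rightarrow> 'v \<Rightarrow> 'v \<Rightarrow> bool" where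
  "adjacent G u v \<longleftrightarrow> (u, v) \<in> edges G \<or> (v, u) \<in> edges G"

definition neighbours :: "('v, 'x) metric_graph_scheme \<Rightarrow> 'v \<Rightarrow> 'v set" where
  "neighbours G v = {w. adjacent G v w}"

text \<open>The second condition excludes both loops (\<open>u = v\<close>) and multiple edges.\<close>

definition metric_graph :: "('v, 'x) metric_graph_scheme \<Rightarrow> bool" where
  "metric_graph G \<longleftrightarrow>
     edges G \<subseteq> verts G \<times> verts G \<and>
     (\<forall>u v. (u, v) \<in> edges G \<longrightarrow> (v, u) \<notin> edges G) \<and>
     (\<forall>v\<in>verts G. finite (neighbours G v)) \<and>
     (\<exists>c>0. \<forall>e\<in>edges G. c \<le> len G e)"

definition compact_graph :: "('v, 'x) metric_graph_scheme \<Rightarrow> bool" where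
  "compact_graph G \<longleftrightarrow> finite (verts G) \<and> finite (edges G)"

definition regular_graph :: "nat \<Rightarrow> ('v, 'x) metric_graph_scheme \<Rightarrow> bool" where
  "regular_graph d G \<longleftrightarrow> (\<forall>v\<in>verts G. card (neighbours G v) = d)"

definition connected_graph :: "('v, 'x) metric_graph_scheme \<Rightarrow> bool" where
  "connected_graph G \<longleftrightarrow>
     verts G \<noteq> {} \<and> (\<forall>u\<in>verts G. \<forall>v\<in>verts G. (adjacent G)\<^sup>*\<^sup>* u v)"

definition is_cycle :: "('v, 'x) metric_graph_scheme \<Rightarrow> 'v list \<Rightarrow> bool" where
  "is_cycle G p \<longleftrightarrow>
     length p \<ge> 3 \<and> distinct p \<and>
     (\<forall>i<length p. adjacent G (p ! i) (p ! (Suc i mod length p)))"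

definition tree_graph :: "('v, 'x) metric_graph_scheme \<Rightarrow> bool" where
  "tree_graph G \<longleftrightarrow> connected_graph G \<and> (\<nexists>p. is_cycle G p)"


section \<open>Quantum graphs with delta-type vertex conditions\<close>

text \<open>
  The constant \<open>\<alpha>\<close> of a vertex ranges over the reals together with \<open>\<infinity>\<close>; the value \<open>-\<infinity>\<close>
  is excluded in \<open>quantum_graph\<close>.
\<close>

record 'v quantum_graph = "'v metric_graph" +
  pot :: "'v \<times> 'v \<Rightarrow> real \<Rightarrow> real"
  alpha :: "'v \<Rightarrow> ereal"

definition quantum_graph :: "'v quantum_graph \<Rightarrow> bool" where
  "quantum_graph G \<longleftrightarrow>
     metric_graph G \<and>
     (\<forall>e\<in>edges G. continuous_on {0..len G e} (pot G e)) \<and>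
     (\<forall>v\<in>verts G. alpha G v \<noteq> -\<infinity>)"

definition L2_on :: "real \<Rightarrow> (real \<Rightarrow> complex) \<Rightarrow> bool" where
  "L2_on l g \<longleftrightarrow>
     g \<in> borel_measurable (lebesgue_on {0..l}) \<and>
     integrable (lebesgue_on {0..l}) (\<lambda>x. (cmod (g x))\<^sup>2)"

text \<open>
  \<open>H1_deriv l g h\<close>: on \<open>[0, l]\<close>, \<open>g\<close> is the absolutely continuous representative of an element of
  the Sobolev space \<open>H\<^sup>1\<close> and \<open>h\<close> is a representative of its weak derivative.
  In \<open>H2_derivs l f f1 f2\<close> the function \<open>f1\<close> is thereby the actual (continuous) first derivative
  of \<open>f\<close>, so that its values at the ends of the interval are meaningful.
\<close>

definition H1_deriv :: "real \<Rightarrow> (real \<Rightarrow> complex) \<Rightarrow> (real \<Rightarrow> complex) \<Rightarrow> bool" where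
  "H1_deriv l g h \<longleftrightarrow>
     L2_on l h \<and> (\<forall>x\<in>{0..l}. g x = g 0 + (\<integral>t. h t \<partial>lebesgue_on {0..x}))"

definition H2_derivs ::
  "real \<Rightarrow> (real \<Rightarrow> complex) \<Rightarrow> (real \<Rightarrow> complex) \<Rightarrow> (real \<Rightarrow> complex) \<Rightarrow> bool" where
  "H2_derivs l f f1 f2 \<longleftrightarrow> H1_deriv l f f1 \<and> H1_deriv l f1 f2"

definition H2_norm_sq ::
  "real \<Rightarrow> (real \<Rightarrow> complex) \<Rightarrow> (real \<Rightarrow> complex) \<Rightarrow> (real \<Rightarrow> complex) \<Rightarrow> real" where
  "H2_norm_sq l f f1 f2 =
     (\<integral>x. (cmod (f x))\<^sup>2 + (cmod (f1 x))\<^sup>2 + (cmod (f2 x))\<^sup>2 \<partial>lebesgue_on {0..l})"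

text \<open>
  The number \<open>c\<close> is the common value of \<open>f\<close> at \<open>v\<close>. At the end of an edge, the derivative in the
  direction pointing into the edge is \<open>f1\<close> at \<open>0\<close>, but minus \<open>f1\<close> at \<open>len G e\<close>.
\<close>

definition vertex_condition ::
  "'v quantum_graph \<Rightarrow> ('v \<times> 'v \<Rightarrow> real \<Rightarrow> complex) \<Rightarrow> ('v \<times> 'v \<Rightarrow> real \<Rightarrow> complex)
     \<Rightarrow> 'v \<Rightarrow> bool" where
  "vertex_condition G f f1 v \<longleftrightarrow>
     (\<exists>c. (\<forall>e\<in>edges G. fst e = v \<longrightarrow> f e 0 = c) \<and>
          (\<forall>e\<in>edges G. snd e = v \<longrightarrow> f e (len G e) = c) \<and>
          (if alpha G v = \<infinity> then c = 0
           else (\<Sum>e | e \<in> edges G \<and> fst e = v. f1 e 0)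
                + (\<Sum>e | e \<in> edges G \<and> snd e = v. - f1 e (len G e))
                = complex_of_real (real_of_ereal (alpha G v)) * c))"

definition in_domain ::
  "'v quantum_graph \<Rightarrow> ('v \<times> 'v \<Rightarrow> real \<Rightarrow> complex) \<Rightarrow> ('v \<times> 'v \<Rightarrow> real \<Rightarrow> complex)
     \<Rightarrow> ('v \<times> 'v \<Rightarrow> real \<Rightarrow> complex) \<Rightarrow> bool" where
  "in_domain G f f1 f2 \<longleftrightarrow>
     (\<forall>e\<in>edges G. H2_derivs (len G e) (f e) (f1 e) (f2 e)) \<and>
     (\<lambda>e. H2_norm_sq (len G e) (f e) (f1 e) (f2 e)) summable_on edges G \<and>
     (\<forall>v\<in>verts G. vertex_condition G f f1 v)"

text \<open>
  \<open>schroedinger_op G f u\<close>: \<open>f\<close> lies in the domain of the operator of \<open>G\<close>, and \<open>u\<close>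
  represents its image.
\<close>

definition schroedinger_op ::
  "'v quantum_graph \<Rightarrow> ('v \<times> 'v \<Rightarrow> real \<Rightarrow> complex) \<Rightarrow> ('v \<times> 'v \<Rightarrow> real \<Rightarrow> complex)
     \<Rightarrow> bool" where
  "schroedinger_op G f u \<longleftrightarrow>
     (\<exists>f1 f2. in_domain G f f1 f2 \<and>
        (\<forall>e\<in>edges G. AE x in lebesgue_on {0..len G e}.
           u e x = - f2 e x + complex_of_real (pot G e x) * f e x))"

text \<open>
  Functions in the domain are continuous on every edge, so being nonzero in the Hilbert space
  means being nonzero at some point.
\<close>

definition point_spectrum :: "'v quantum_graph \<Rightarrow> complex set" where
  "point_spectrum G =
     {z. \<exists>f. schroedinger_op G f (\<lambda>e x. z * f e x) \<and>
            (\<exists>e\<in>edges G. \<exists>x\<in>{0..len G e}. f e x \<noteq> 0)}"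


section \<open>Universal covers\<close>

text \<open>
  A universal cover is a tree with a covering map onto a connected graph; it is determined up to
  isomorphism over \<open>G\<close>.
  The identification of the edges with intervals is lifted as well, through the orientation.
\<close>

definition covering_map ::
  "('w, 'y) metric_graph_scheme \<Rightarrow> ('v, 'x) metric_graph_scheme \<Rightarrow> ('w \<Rightarrow> 'v) \<Rightarrow> bool" where
  "covering_map T G \<Xi> \<longleftrightarrow>
     \<Xi> ` verts T = verts G \<and>
     (\<forall>v\<in>verts T. bij_betw \<Xi> (neighbours T v) (neighbours G (\<Xi> v)))"

definition universal_cover ::
  "'w quantum_graph \<Rightarrow> 'v quantum_graph \<Rightarrow> ('w \<Rightarrow> 'v) \<Rightarrow> bool" where
  "universal_cover T G \<Xi> \<longleftrightarrow>
     quantum_graph T \<and> tree_graph T \<and> covering_map T G \<Xi> \<and>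
     (\<forall>e\<in>edges T. map_prod \<Xi> \<Xi> e \<in> edges G \<and>
        len T e = len G (map_prod \<Xi> \<Xi> e) \<and>
        (\<forall>x\<in>{0..len T e}. pot T e x = pot G (map_prod \<Xi> \<Xi> e) x)) \<and>
     (\<forall>v\<in>verts T. alpha T v = alpha G (\<Xi> v))"


section \<open>The Dirichlet problem on an interval\<close>

definition dirichlet_solvable :: "real \<Rightarrow> (real \<Rightarrow> real) \<Rightarrow> complex \<Rightarrow> bool" where
  "dirichlet_solvable l W z \<longleftrightarrow>
     (\<exists>f f' f'' :: real \<Rightarrow> complex.
        (\<forall>x\<in>{0..l}. (f has_vector_derivative f' x) (at x within {0..l})) \<and>
        (\<forall>x\<in>{0..l}. (f' has_vector_derivative f'' x) (at x within {0..l})) \<and>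
        (\<forall>x\<in>{0..l}. - f'' x + complex_of_real (W x) * f x = z * f x) \<and>
        f 0 = 0 \<and> f l = 0 \<and> (\<exists>x\<in>{0..l}. f x \<noteq> 0))"

end

theory Submission
  imports Defs
begin

text \<open>
  Fix \<open>z\<close> and suppose that no edge of \<open>\<Gamma>\<close> has a Dirichlet solution at \<open>z\<close>. On every edge a solution of
  \<open>- f'' + W f = z f\<close> is then determined by its two endpoint values, and the outgoing derivative at one end is
  \<open>A\<close> times the value at the other end plus a multiple of the value at the same end, with one nonzero
  coefficient \<open>A\<close> for both ends (\<open>dirichlet_to_neumann\<close>). Restricting an eigenfunction on \<open>T\<close> to the
  vertices therefore gives a square-summable solution \<open>\<phi>\<close> of a Jacobi equation
  \<open>(\<Sum>y\<in>neighbours x. a x y * \<phi> y) = b x * \<phi> x\<close> with symmetric, nowhere vanishing off-diagonal coefficients lifted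
  from \<open>\<Gamma>\<close>. It remains to see that on the universal cover of a finite \<open>d\<close>-regular graph, \<open>d \<ge> 2\<close>, the only such
  solution is zero; then the eigenfunction would vanish at all vertices and be a Dirichlet solution on some edge.
  
  The reason is a counting argument for energies (squared norms), in the spirit of Aomoto's index theorem. Call
  a vertex of \<open>\<Gamma>\<close> supporting if some square-summable solution on \<open>T\<close> is nonzero above it. The Wronskian of two
  square-summable solutions on a branch of \<open>T\<close> vanishes (\<open>wronskian_bound_zero\<close>), so at a supporting vertex
  \<open>u\<close> all solutions have the same ratios to the values at the neighbours. Consider the solution with value \<open>1\<close> at \<open>u\<close> of least
  energy, and let \<open>share u w\<close> be the fraction of its energy that lies beyond the neighbour \<open>w\<close>.
  
  \<^item> The shares at \<open>u\<close> add up to less than \<open>1\<close>, as \<open>u\<close> itself carries energy (\<open>sum_share\<close>).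
  \<^item> For an edge between supporting vertices the two optimal solutions are proportional, so the two shares of the edge add up
    to \<open>1\<close> (\<open>share_inside\<close> proves the inequality that is needed).
  \<^item> At a vertex \<open>v\<close> that is not supporting, all solutions vanish; minimising the energy under the single equation at
    \<open>v\<close> shows that the shares sent across \<open>v\<close> by its supporting neighbours add up to at least \<open>1\<close>
    (\<open>share_outside\<close>).
  
  As every vertex has \<open>d\<close> neighbours and \<open>d \<ge> 2\<close>, summing \<open>share u w - 1 / d\<close> over all supporting \<open>u\<close> and their
  neighbours is negative by the first item and nonnegative by the other two (\<open>support_empty\<close>), unless no
  vertex is supporting.
  
  Ratios and least energies have to depend only on vertices of \<open>\<Gamma>\<close>. This is achieved by describing
  branches of \<open>T\<close> coinductively over \<open>\<Gamma>\<close> (\<open>branch\<close>); the tree \<open>T\<close> is only used to see that an eigenfunction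
  gives rise to such branches (\<open>tree_branch_energy\<close>, \<open>lifted_solution_zero\<close>).
\<close>

section \<open>Square-summable solutions of Jacobi equations over regular graphs\<close>

text \<open>
  The coefficients are those of a Jacobi equation at an arbitrary complex spectral parameter, hence
  complex and symmetric rather than Hermitian; accordingly the arguments below use the bilinear Wronskian.
\<close>

locale regular_jacobi =
  fixes V :: "'v set" and nb :: "'v \<Rightarrow> 'v set" and a :: "'v \<Rightarrow> 'v \<Rightarrow> complex"
    and b :: "'v \<Rightarrow> complex" and d :: nat
  assumes finite_V: "finite V"
    and nb_in_V: "v \<in> V \<Longrightarrow> nb v \<subseteq> V"
    and nb_sym: "w \<in> nb v \<Longrightarrow> v \<in> nb w"
    and card_nb: "v \<in> V \<Longrightarrow> card (nb v) = d"
    and d_ge_2: "2 \<le> d"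
    and a_sym: "a v w = a w v"
    and a_nonzero: "v \<in> V \<Longrightarrow> w \<in> nb v \<Longrightarrow> a v w \<noteq> 0"
begin

text \<open>
  Cut the edge between \<open>v\<close> and \<open>u\<close> in the universal cover and keep the subtree that contains \<open>u\<close>:
  its shape and its coefficients depend only on the pair \<open>(u, v)\<close> in the finite graph.
  \<open>branch u v \<alpha> \<beta> E\<close> says that this subtree carries a solution which has the value \<open>\<alpha>\<close> at \<open>u\<close>,
  is continued by the value \<open>\<beta>\<close> at \<open>v\<close>, and has squared norm at most \<open>E\<close>. The greatest fixed
  point describes infinite trees without constructing them: branches with matching values can be
  glued at a vertex by one application of the rule, and deck transformations never appear.
  The premise \<open>0 \<le> E\<close> matters, since a coinductive bound could otherwise escape to \<open>-\<infinity>\<close>.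
\<close>

coinductive branch :: "'v \<Rightarrow> 'v \<Rightarrow> complex \<Rightarrow> complex \<Rightarrow> real \<Rightarrow> bool" where
  step: "\<lbrakk>0 \<le> E;
     (\<Sum>w\<in>nb u - {v}. a u w * g w) + a u v * \<beta> = b u * \<alpha>;
     (cmod \<alpha>)\<^sup>2 + (\<Sum>w\<in>nb u - {v}. E' w) \<le> E;
     \<And>w. w \<in> nb u - {v} \<Longrightarrow> branch w u (g w) \<alpha> (E' w)\<rbrakk>
   \<Longrightarrow> branch u v \<alpha> \<beta> E"

lemma finite_nb: "v \<in> V \<Longrightarrow> finite (nb v)"
  using finite_V nb_in_V finite_subset by blast

lemma branchE:
  assumes "branch u v \<alpha> \<beta> E"
  obtains g E' where "(\<Sum>w\<in>nb u - {v}. a u w * g w) + a u v * \<beta> = b u * \<alpha>"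
    and "(cmod \<alpha>)\<^sup>2 + (\<Sum>w\<in>nb u - {v}. E' w) \<le> E"
    and "\<And>w. w \<in> nb u - {v} \<Longrightarrow> branch w u (g w) \<alpha> (E' w)"
  using assms by (cases rule: branch.cases) blast

lemma branch_nonneg: "branch u v \<alpha> \<beta> E \<Longrightarrow> 0 \<le> E"
  by (erule branch.cases) auto

lemma branch_energy_ge:
  assumes "branch u v \<alpha> \<beta> E"
  shows "(cmod \<alpha>)\<^sup>2 \<le> E"
proof -
  obtain g E' where "(\<Sum>w\<in>nb u - {v}. a u w * g w) + a u v * \<beta> = b u * \<alpha>" 
    and *: "(cmod \<alpha>)\<^sup>2 + (\<Sum>w\<in>nb u - {v}. E' w) \<le> E"
    "\<And>w. w \<in> nb u - {v} \<Longrightarrow> branch w u (g w) \<alpha> (E' w)"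
    by (rule branchE[OF assms]) (rule that)
  have "0 \<le> (\<Sum>w\<in>nb u - {v}. E' w)"
    by (rule sum_nonneg) (use * branch_nonneg in blast)
  with * show ?thesis by linarith
qed

lemma branch_coinduct:
  assumes "X u v \<alpha> \<beta> E"
    and "\<And>u v \<alpha> \<beta> E. X u v \<alpha> \<beta> E \<Longrightarrow> \<exists>g E'. 0 \<le> E \<and>
      (\<Sum>w\<in>nb u - {v}. a u w * g w) + a u v * \<beta> = b u * \<alpha> \<and>
      (cmod \<alpha>)\<^sup>2 + (\<Sum>w\<in>nb u - {v}. E' w) \<le> E \<and>
      (\<forall>w\<in>nb u - {v}. X w u (g w) \<alpha> (E' w))"
  shows "branch u v \<alpha> \<beta> E"
  using assms(1)
proof (rule branch.coinduct)
  fix u v \<alpha> \<beta> E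
  assume "X u v \<alpha> \<beta> E"
  from assms(2)[OF this] show "\<exists>E' u' g v' \<beta>' \<alpha>' E''.
      u = u' \<and> v = v' \<and> \<alpha> = \<alpha>' \<and> \<beta> = \<beta>' \<and> E = E' \<and> 0 \<le> E' \<and>
      (\<Sum>w\<in>nb u' - {v'}. a u' w * g w) + a u' v' * \<beta>' = b u' * \<alpha>' \<and>
      (cmod \<alpha>')\<^sup>2 + sum E'' (nb u' - {v'}) \<le> E' \<and>
      (\<forall>w. w \<in> nb u' - {v'} \<longrightarrow> X w u' (g w) \<alpha>' (E'' w) \<or> branch w u' (g w) \<alpha>' (E'' w))"
    by blast
qed

lemma branch_zero: "branch u v 0 0 0"
  by (rule branch_coinduct[of "\<lambda>u v \<alpha> \<beta> E. \<alpha> = 0 \<and> \<beta> = 0 \<and> E = 0"])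
     (auto intro!: exI[of _ "\<lambda>_. 0"])

lemma branch_scale:
  assumes "branch u v \<alpha> \<beta> E"
  shows "branch u v (c * \<alpha>) (c * \<beta>) ((cmod c)\<^sup>2 * E)"
proof (rule branch_coinduct[of "\<lambda>u v x y F. \<exists>\<alpha> \<beta> E. branch u v \<alpha> \<beta> E \<and> x = c * \<alpha> \<and> y = c * \<beta> \<and> F = (cmod c)\<^sup>2 * E"])
  fix u v x y F
  assume "\<exists>\<alpha> \<beta> E. branch u v \<alpha> \<beta> E \<and> x = c * \<alpha> \<and> y = c * \<beta> \<and> F = (cmod c)\<^sup>2 * E"
  then obtain \<alpha> \<beta> E where B: "branch u v \<alpha> \<beta> E" and xy: "x = c * \<alpha>" "y = c * \<beta>" "F = (cmod c)\<^sup>2 * E"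
    by (elim exE conjE)
  obtain g E' where *: "(\<Sum>w\<in>nb u - {v}. a u w * g w) + a u v * \<beta> = b u * \<alpha>"
      "(cmod \<alpha>)\<^sup>2 + (\<Sum>w\<in>nb u - {v}. E' w) \<le> E"
      "\<And>w. w \<in> nb u - {v} \<Longrightarrow> branch w u (g w) \<alpha> (E' w)"
    by (rule branchE[OF B]) (rule that)
  have "(\<Sum>w\<in>nb u - {v}. a u w * (c * g w)) = c * (\<Sum>w\<in>nb u - {v}. a u w * g w)"
    by (simp add: sum_distrib_left mult.left_commute)
  then have eq: "(\<Sum>w\<in>nb u - {v}. a u w * (c * g w)) + a u v * y = b u * x"
    using *(1) unfolding xy by (metis (no_types) distrib_left mult.left_commute)
  have le: "(cmod x)\<^sup>2 + (\<Sum>w\<in>nb u - {v}. (cmod c)\<^sup>2 * E' w) \<le> F"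
    using mult_left_mono[OF *(2), of "(cmod c)\<^sup>2"] unfolding xy
    by (simp add: sum_distrib_left[symmetric] distrib_left norm_mult power_mult_distrib)
  have F: "0 \<le> F" using xy branch_nonneg[OF B] by simp
  show "\<exists>g E'. 0 \<le> F \<and> (\<Sum>w\<in>nb u - {v}. a u w * g w) + a u v * y = b u * x \<and>
      (cmod x)\<^sup>2 + (\<Sum>w\<in>nb u - {v}. E' w) \<le> F \<and>
      (\<forall>w\<in>nb u - {v}. \<exists>\<alpha> \<beta> E. branch w u \<alpha> \<beta> E \<and> g w = c * \<alpha> \<and> x = c * \<beta> \<and> E' w = (cmod c)\<^sup>2 * E)"
    by (rule exI[of _ "\<lambda>w. c * g w"], rule exI[of _ "\<lambda>w. (cmod c)\<^sup>2 * E' w"])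
       (use F eq le *(3) xy(1) in metis)
qed (rule exI[of _ \<alpha>], rule exI[of _ \<beta>], rule exI[of _ E], simp add: assms)

definition wronskian :: "'v \<Rightarrow> 'v \<Rightarrow> complex \<Rightarrow> complex \<Rightarrow> complex \<Rightarrow> complex \<Rightarrow> complex" where
  "wronskian u v \<alpha> \<beta> \<alpha>' \<beta>' = a u v * (\<alpha> * \<beta>' - \<alpha>' * \<beta>)"

text \<open>
  Green's identity at one vertex: the diagonal terms cancel, so the flux through the root edge of a
  branch is the sum of the fluxes through the edges one level further out.
\<close>

lemma wronskian_step:
  assumes 1: "(\<Sum>w\<in>nb u - {v}. a u w * g w) + a u v * \<beta> = b u * \<alpha>"
    and 2: "(\<Sum>w\<in>nb u - {v}. a u w * g' w) + a u v * \<beta>' = b u * \<alpha>'"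
  shows "wronskian u v \<alpha> \<beta> \<alpha>' \<beta>' = (\<Sum>w\<in>nb u - {v}. wronskian w u (g w) \<alpha> (g' w) \<alpha>')"
proof -
  have S: "(\<Sum>w\<in>nb u - {v}. a u w * g w) = b u * \<alpha> - a u v * \<beta>"
    and S': "(\<Sum>w\<in>nb u - {v}. a u w * g' w) = b u * \<alpha>' - a u v * \<beta>'"
    using 1 2 by (simp_all add: eq_diff_eq)
  have "(\<Sum>w\<in>nb u - {v}. wronskian w u (g w) \<alpha> (g' w) \<alpha>')
      = \<alpha>' * (\<Sum>w\<in>nb u - {v}. a u w * g w) - \<alpha> * (\<Sum>w\<in>nb u - {v}. a u w * g' w)"
    unfolding wronskian_def sum_distrib_left sum_subtractf[symmetric]
    by (rule sum.cong) (auto simp: a_sym[of _ u] algebra_simps)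
  also have "\<dots> = wronskian u v \<alpha> \<beta> \<alpha>' \<beta>'"
    unfolding S S' wronskian_def by (simp add: algebra_simps)
  finally show ?thesis by simp
qed

lemma product_le_sqrt: 
  fixes x y s q :: real assumes "0 \<le> x" "0 \<le> y" "x\<^sup>2 \<le> q" "y\<^sup>2 \<le> s"
  shows "x * y \<le> sqrt (s * q)"
proof (rule real_le_rsqrt)
  have "x\<^sup>2 * y\<^sup>2 \<le> q * s" using assms by (intro mult_mono) (auto intro: order_trans[OF zero_le_power2])
  then show "(x * y)\<^sup>2 \<le> s * q" by (simp add: power_mult_distrib mult.commute)
qed

text \<open>
  The flux involves the values at \<open>u\<close> only through one factor of each product, hence the
  geometric mean of the energy at \<open>u\<close> alone and the energy of the whole branch. If the
  vertex \<open>u\<close> carries a small part of the energy, this beats any bound that is linear in the energy.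
\<close>

lemma wronskian_crude:
  obtains D where "0 < D"
    "\<And>u v \<alpha> \<beta> E \<alpha>' \<beta>' E'. \<lbrakk>u \<in> V; v \<in> nb u; branch u v \<alpha> \<beta> E; branch u v \<alpha>' \<beta>' E'\<rbrakk> \<Longrightarrow>
        cmod (wronskian u v \<alpha> \<beta> \<alpha>' \<beta>') \<le> D * sqrt (((cmod \<alpha>)\<^sup>2 + (cmod \<alpha>')\<^sup>2) * (E + E'))"
proof -
  define A where "A = (\<Sum>u\<in>V. \<Sum>w\<in>V. cmod (a u w))"
  have A: "cmod (a u w) \<le> A" if "u \<in> V" "w \<in> V" for u w
  proof -
    have "cmod (a u w) \<le> (\<Sum>w\<in>V. cmod (a u w))"
      using that by (intro member_le_sum) (auto simp: finite_V)
    also have "\<dots> \<le> A"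
      unfolding A_def using that by (intro member_le_sum[of u V "\<lambda>u. \<Sum>w\<in>V. cmod (a u w)"])
        (auto simp: finite_V sum_nonneg)
    finally show ?thesis .
  qed
  have A0: "0 \<le> A" unfolding A_def by (simp add: sum_nonneg)
  define D where "D = 2 * A * d + 1"
  have D: "0 < D" using A0 by (auto simp: D_def intro: add_nonneg_pos)
  show thesis
  proof (rule that[OF D])
    fix u v \<alpha> \<beta> E \<alpha>' \<beta>' E'
    assume u: "u \<in> V" and v: "v \<in> nb u" and B: "branch u v \<alpha> \<beta> E" and B': "branch u v \<alpha>' \<beta>' E'"
    obtain g F where g: "(\<Sum>w\<in>nb u - {v}. a u w * g w) + a u v * \<beta> = b u * \<alpha>"
        "(cmod \<alpha>)\<^sup>2 + (\<Sum>w\<in>nb u - {v}. F w) \<le> E"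
        "\<And>w. w \<in> nb u - {v} \<Longrightarrow> branch w u (g w) \<alpha> (F w)"
      by (rule branchE[OF B]) (rule that)
    obtain g' F' where g': "(\<Sum>w\<in>nb u - {v}. a u w * g' w) + a u v * \<beta>' = b u * \<alpha>'"
        "(cmod \<alpha>')\<^sup>2 + (\<Sum>w\<in>nb u - {v}. F' w) \<le> E'"
        "\<And>w. w \<in> nb u - {v} \<Longrightarrow> branch w u (g' w) \<alpha>' (F' w)"
      by (rule branchE[OF B']) (rule that)
    define q where "q = E + E'"
    define s where "s = (cmod \<alpha>)\<^sup>2 + (cmod \<alpha>')\<^sup>2"
    have summand: "cmod (wronskian w u (g w) \<alpha> (g' w) \<alpha>') \<le> 2 * A * sqrt (s * q)"
      if w: "w \<in> nb u - {v}" for w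
    proof -
      have "F w \<le> (\<Sum>w\<in>nb u - {v}. F w)"
        using w u g(3) by (intro member_le_sum) (auto simp: finite_nb dest: branch_nonneg)
      then have "(cmod (g w))\<^sup>2 \<le> q"
        using branch_energy_ge[OF g(3)[OF w]] g(2) branch_nonneg[OF B'] zero_le_power2[of "cmod \<alpha>"]
        unfolding q_def by linarith
      moreover have "F' w \<le> (\<Sum>w\<in>nb u - {v}. F' w)"
        using w u g'(3) by (intro member_le_sum) (auto simp: finite_nb dest: branch_nonneg)
      then have "(cmod (g' w))\<^sup>2 \<le> q"
        using branch_energy_ge[OF g'(3)[OF w]] g'(2) branch_nonneg[OF B] zero_le_power2[of "cmod \<alpha>'"]
        unfolding q_def by linarith
      ultimately have "cmod (g w) * cmod \<alpha>' \<le> sqrt (s * q)" "cmod (g' w) * cmod \<alpha> \<le> sqrt (s * q)"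
        by (auto intro!: product_le_sqrt simp: s_def)
      then have "cmod (g w * \<alpha>' - g' w * \<alpha>) \<le> 2 * sqrt (s * q)"
        using norm_triangle_ineq4[of "g w * \<alpha>'" "g' w * \<alpha>"] by (simp add: norm_mult)
      moreover have "cmod (a w u) \<le> A" using A w u nb_in_V by blast
      ultimately have "cmod (a w u) * cmod (g w * \<alpha>' - g' w * \<alpha>) \<le> A * (2 * sqrt (s * q))"
        using A0 by (intro mult_mono) auto
      then show ?thesis by (simp add: wronskian_def norm_mult)
    qed
    have q0: "0 \<le> s * q" 
      unfolding s_def q_def using branch_nonneg[OF B] branch_nonneg[OF B'] by (intro mult_nonneg_nonneg) auto
    have "cmod (wronskian u v \<alpha> \<beta> \<alpha>' \<beta>') \<le> (\<Sum>w\<in>nb u - {v}. 2 * A * sqrt (s * q))"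
      unfolding wronskian_step[OF g(1) g'(1)] by (rule sum_norm_le) (rule summand)
    also have "\<dots> = card (nb u - {v}) * (2 * A * sqrt (s * q))" by simp
    also have "\<dots> \<le> d * (2 * A * sqrt (s * q))"
      using card_nb[OF u] card_Diff1_le[of "nb u" v] A0 q0 by (intro mult_right_mono) auto
    also have "\<dots> \<le> D * sqrt (s * q)"
      using q0 by (simp add: D_def algebra_simps)
    finally show "cmod (wronskian u v \<alpha> \<beta> \<alpha>' \<beta>') \<le> D * sqrt (((cmod \<alpha>)\<^sup>2 + (cmod \<alpha>')\<^sup>2) * (E + E'))"
      by (simp add: s_def q_def)
  qed
qed

definition wronskian_bound :: "real \<Rightarrow> bool" where
  "wronskian_bound \<delta> \<longleftrightarrow> 0 \<le> \<delta> \<and>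
     (\<forall>u v \<alpha> \<beta> E \<alpha>' \<beta>' E'. u \<in> V \<longrightarrow> v \<in> nb u \<longrightarrow> branch u v \<alpha> \<beta> E \<longrightarrow> branch u v \<alpha>' \<beta>' E' \<longrightarrow>
        cmod (wronskian u v \<alpha> \<beta> \<alpha>' \<beta>') \<le> \<delta> * (E + E'))"

text \<open>
  Pushing the flux one level outwards replaces the energies by those of the subbranches, and so
  gains the energy that sits at \<open>u\<close>.
\<close>

lemma wronskian_bound_improve:
  assumes "wronskian_bound \<delta>" "u \<in> V" "v \<in> nb u" "branch u v \<alpha> \<beta> E" "branch u v \<alpha>' \<beta>' E'"
  shows "cmod (wronskian u v \<alpha> \<beta> \<alpha>' \<beta>') \<le> \<delta> * (E + E' - ((cmod \<alpha>)\<^sup>2 + (cmod \<alpha>')\<^sup>2))"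
proof -
    obtain g F where g: "(\<Sum>w\<in>nb u - {v}. a u w * g w) + a u v * \<beta> = b u * \<alpha>"
        "(cmod \<alpha>)\<^sup>2 + (\<Sum>w\<in>nb u - {v}. F w) \<le> E"
        "\<And>w. w \<in> nb u - {v} \<Longrightarrow> branch w u (g w) \<alpha> (F w)"
      by (rule branchE[OF assms(4)]) (rule that)
    obtain g' F' where g': "(\<Sum>w\<in>nb u - {v}. a u w * g' w) + a u v * \<beta>' = b u * \<alpha>'"
        "(cmod \<alpha>')\<^sup>2 + (\<Sum>w\<in>nb u - {v}. F' w) \<le> E'"
        "\<And>w. w \<in> nb u - {v} \<Longrightarrow> branch w u (g' w) \<alpha>' (F' w)"
      by (rule branchE[OF assms(5)]) (rule that)
    have "cmod (wronskian u v \<alpha> \<beta> \<alpha>' \<beta>') \<le> (\<Sum>w\<in>nb u - {v}. \<delta> * (F w + F' w))"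
      unfolding wronskian_step[OF g(1) g'(1)]
    proof (rule sum_norm_le)
      fix w assume w: "w \<in> nb u - {v}"
      then have "w \<in> V" "u \<in> nb w" using assms nb_in_V nb_sym by auto
      then show "cmod (wronskian w u (g w) \<alpha> (g' w) \<alpha>') \<le> \<delta> * (F w + F' w)"
        using assms(1) g(3)[OF w] g'(3)[OF w] unfolding wronskian_bound_def by blast
    qed
    also have "\<dots> = \<delta> * ((\<Sum>w\<in>nb u - {v}. F w) + (\<Sum>w\<in>nb u - {v}. F' w))"
      by (simp add: sum_distrib_left[symmetric] sum.distrib)
    also have "\<dots> \<le> \<delta> * (E + E' - ((cmod \<alpha>)\<^sup>2 + (cmod \<alpha>')\<^sup>2))"
      using assms(1) g(2) g'(2) unfolding wronskian_bound_def by (intro mult_left_mono) auto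
    finally show ?thesis .
qed

text \<open>
  The flux of two square-summable solutions vanishes because nothing arrives from infinity. Instead of
  summing over spheres of growing radius, consider the best constant \<open>\<delta>\<close>: either a fixed
  fraction of the energy sits at the root, and then pushing the flux outwards improves \<open>\<delta>\<close>,
  or it does not, and then the geometric mean bound is better than \<open>\<delta>\<close>. So \<open>\<delta> > 0\<close> is
  impossible.
\<close>

lemma wronskian_bound_zero: "wronskian_bound 0"
proof -
  obtain D where D: "0 < D"
    "\<And>u v \<alpha> \<beta> E \<alpha>' \<beta>' E'. \<lbrakk>u \<in> V; v \<in> nb u; branch u v \<alpha> \<beta> E; branch u v \<alpha>' \<beta>' E'\<rbrakk> \<Longrightarrow>
        cmod (wronskian u v \<alpha> \<beta> \<alpha>' \<beta>') \<le> D * sqrt (((cmod \<alpha>)\<^sup>2 + (cmod \<alpha>')\<^sup>2) * (E + E'))"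
    using wronskian_crude by blast
  define X where "X = {\<delta>. wronskian_bound \<delta>}"
  have DX: "D \<in> X"
    unfolding X_def wronskian_bound_def mem_Collect_eq
  proof (intro conjI allI impI)
    fix u v \<alpha> \<beta> E \<alpha>' \<beta>' E'
    assume *: "u \<in> V" "v \<in> nb u" "branch u v \<alpha> \<beta> E" "branch u v \<alpha>' \<beta>' E'"
    have "((cmod \<alpha>)\<^sup>2 + (cmod \<alpha>')\<^sup>2) * (E + E') \<le> (E + E') * (E + E')"
      using branch_energy_ge[OF *(3)] branch_energy_ge[OF *(4)] branch_nonneg[OF *(3)] branch_nonneg[OF *(4)]
      by (intro mult_right_mono) auto
    then have "sqrt (((cmod \<alpha>)\<^sup>2 + (cmod \<alpha>')\<^sup>2) * (E + E')) \<le> E + E'"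
      using branch_nonneg[OF *(3)] branch_nonneg[OF *(4)] 
      by (intro real_le_lsqrt) (auto simp: power2_eq_square)
    then have "D * sqrt (((cmod \<alpha>)\<^sup>2 + (cmod \<alpha>')\<^sup>2) * (E + E')) \<le> D * (E + E')"
      using D(1) by simp
    with D(2)[OF *] show "cmod (wronskian u v \<alpha> \<beta> \<alpha>' \<beta>') \<le> D * (E + E')" by linarith
  qed (use D in auto)
  have bdd: "bdd_below X" unfolding X_def wronskian_bound_def by (auto simp: bdd_below_def)
  define \<delta> where "\<delta> = Inf X"
  have \<delta>0: "0 \<le> \<delta>" unfolding \<delta>_def using DX by (intro cInf_greatest) (auto simp: X_def wronskian_bound_def)
  have \<delta>D: "\<delta> \<le> D" unfolding \<delta>_def using DX bdd by (rule cInf_lower)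
  have \<delta>X: "wronskian_bound \<delta>"
    unfolding wronskian_bound_def
  proof (intro conjI allI impI \<delta>0)
    fix u v \<alpha> \<beta> E \<alpha>' \<beta>' E'
    assume *: "u \<in> V" "v \<in> nb u" "branch u v \<alpha> \<beta> E" "branch u v \<alpha>' \<beta>' E'"
    let ?W = "cmod (wronskian u v \<alpha> \<beta> \<alpha>' \<beta>')"
    show "?W \<le> \<delta> * (E + E')"
    proof (cases "E + E' = 0")
      case True
      then show ?thesis using DX * unfolding X_def wronskian_bound_def by force
    next
      case False
      then have pos: "E + E' > 0" using branch_nonneg[OF *(3)] branch_nonneg[OF *(4)] by simp
      have "?W / (E + E') \<le> \<delta>"
        unfolding \<delta>_def
        by (rule cInf_greatest) (use DX * pos in \<open>auto simp: X_def wronskian_bound_def divide_simps\<close>)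
      then show ?thesis using pos by (simp add: divide_simps)
    qed
  qed
  have "\<delta> = 0"
  proof (rule ccontr)
    assume "\<delta> \<noteq> 0"
    with \<delta>0 have pos: "\<delta> > 0" by simp
    \<comment> \<open>The fraction of energy at the root that separates the two cases; it is chosen so that the
      geometric mean bound gives \<open>\<delta> / 2\<close>.\<close>
    define t where "t = (\<delta> / (2 * D))\<^sup>2"
    have t: "0 < t" "t \<le> 1/4" 
    proof -
      show "0 < t" unfolding t_def using pos D by simp
      have "(\<delta> / (2 * D))\<^sup>2 \<le> (1/2)\<^sup>2" using pos D \<delta>D by (intro power_mono) (auto simp: divide_simps)
      then show "t \<le> 1/4" unfolding t_def by (simp add: power2_eq_square)
    qed
    have "wronskian_bound (\<delta> * (1 - t))"
      unfolding wronskian_bound_def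
    proof (intro conjI allI impI)
      show "0 \<le> \<delta> * (1 - t)" using t pos by simp
      fix u v \<alpha> \<beta> E \<alpha>' \<beta>' E'
      assume *: "u \<in> V" "v \<in> nb u" "branch u v \<alpha> \<beta> E" "branch u v \<alpha>' \<beta>' E'"
      define s where "s = (cmod \<alpha>)\<^sup>2 + (cmod \<alpha>')\<^sup>2"
      define q where "q = E + E'"
      let ?W = "cmod (wronskian u v \<alpha> \<beta> \<alpha>' \<beta>')"
      have q: "0 \<le> q" using branch_nonneg[OF *(3)] branch_nonneg[OF *(4)] by (simp add: q_def)
      have "?W \<le> \<delta> * (1 - t) * q"
      proof (cases "t * q \<le> s")
        case True
        have "?W \<le> \<delta> * (q - s)"
          using wronskian_bound_improve[OF \<delta>X *] by (simp add: s_def q_def)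
        also have "\<dots> \<le> \<delta> * (q - t * q)" using True pos by (intro mult_left_mono) auto
        finally show ?thesis by (simp add: algebra_simps)
      next
        case False
        have "?W \<le> D * sqrt (s * q)" using D(2)[OF *] by (simp add: s_def q_def)
        also have "\<dots> \<le> D * sqrt (t * q * q)"
          using False q D(1) by (intro mult_left_mono real_sqrt_le_mono mult_right_mono) auto
        also have "sqrt (t * q * q) = \<delta> / (2 * D) * q"
          using q pos D(1) by (simp add: t_def mult.assoc real_sqrt_mult)
        also have "D * (\<delta> / (2 * D) * q) = \<delta> * (1/2) * q" using D(1) by simp
        also have "\<dots> \<le> \<delta> * (1 - t) * q" using t pos q by (intro mult_left_mono mult_right_mono) auto
        finally show ?thesis .
      qed
      then show "?W \<le> \<delta> * (1 - t) * (E + E')" by (simp add: q_def)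
    qed
    then have "\<delta> \<le> \<delta> * (1 - t)" unfolding \<delta>_def using bdd 
      by (metis (no_types) X_def cInf_lower mem_Collect_eq)
    moreover have "0 < \<delta> * t" using pos t by simp
    ultimately show False by (simp add: algebra_simps)
  qed
  with \<delta>X show ?thesis by simp
qed

lemma branch_values_proportional:
  assumes "u \<in> V" "v \<in> nb u" "branch u v \<alpha> \<beta> E" "branch u v \<alpha>' \<beta>' E'"
  shows "\<alpha> * \<beta>' = \<alpha>' * \<beta>"
proof -
  have "cmod (wronskian u v \<alpha> \<beta> \<alpha>' \<beta>') \<le> 0 * (E + E')"
    using wronskian_bound_zero assms unfolding wronskian_bound_def by blast
  then show ?thesis using a_nonzero[OF assms(1,2)] by (simp add: wronskian_def)
qed

definition vertex_solution :: "'v \<Rightarrow> complex \<Rightarrow> bool" where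
  "vertex_solution u \<alpha> \<longleftrightarrow> (\<exists>g E. (\<Sum>w\<in>nb u. a u w * g w) = b u * \<alpha> \<and> (\<forall>w\<in>nb u. branch w u (g w) \<alpha> (E w)))"

text \<open>
  The vertices over which some square-summable solution on the whole cover does not vanish. By
  homogeneity of the cover this is a set of vertices of the finite graph.
\<close>

definition support :: "'v set" where
  "support = {u \<in> V. \<exists>\<alpha>. \<alpha> \<noteq> 0 \<and> vertex_solution u \<alpha>}"

text \<open>
  At a vertex \<open>u\<close> of the support the values of all square-summable solutions at the neighbour \<open>w\<close> are the
  same multiple of the value at \<open>u\<close>. The least energy needed beyond the edge from \<open>u\<close> to
  \<open>w\<close> when the value at \<open>u\<close> is \<open>1\<close> is \<open>branch_cost u w\<close>, and \<open>total_cost u\<close>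
  is the least energy of a solution with value \<open>1\<close> at \<open>u\<close>: for the fixed ratios the branches
  at \<open>u\<close> can be minimised independently.
\<close>

definition ratio :: "'v \<Rightarrow> 'v \<Rightarrow> complex" where
  "ratio u w = (SOME g. \<exists>E. branch w u g 1 E)"

definition branch_cost :: "'v \<Rightarrow> 'v \<Rightarrow> real" where
  "branch_cost u w = Inf {E. branch w u (ratio u w) 1 E}"

definition total_cost :: "'v \<Rightarrow> real" where
  "total_cost u = 1 + (\<Sum>w\<in>nb u. branch_cost u w)"

lemma support_in_V: "u \<in> support \<Longrightarrow> u \<in> V"
  by (simp add: support_def)

lemma vertex_solution_unit:
  assumes "u \<in> support"
  obtains g E where "(\<Sum>w\<in>nb u. a u w * g w) = b u" "\<And>w. w \<in> nb u \<Longrightarrow> branch w u (g w) 1 (E w)"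
proof -
  obtain \<alpha> g E where *: "\<alpha> \<noteq> 0" "(\<Sum>w\<in>nb u. a u w * g w) = b u * \<alpha>"
      "\<And>w. w \<in> nb u \<Longrightarrow> branch w u (g w) \<alpha> (E w)"
    using assms unfolding support_def vertex_solution_def by auto
  show thesis
  proof (rule that)
    have "(\<Sum>w\<in>nb u. a u w * (g w / \<alpha>)) = (\<Sum>w\<in>nb u. a u w * g w) / \<alpha>"
      by (simp add: sum_divide_distrib)
    then show "(\<Sum>w\<in>nb u. a u w * (g w / \<alpha>)) = b u" using * by simp
    show "branch w u (g w / \<alpha>) 1 ((cmod (1 / \<alpha>))\<^sup>2 * E w)" if "w \<in> nb u" for w
      using branch_scale[OF *(3)[OF that], of "1 / \<alpha>"] *(1) by simp
  qed
qed

lemma ratio_branch_ex: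
  assumes "u \<in> support" "w \<in> nb u"
  shows "\<exists>E. branch w u (ratio u w) 1 E"
proof -
  obtain g E where *: "(\<Sum>w\<in>nb u. a u w * g w) = b u" "\<And>w. w \<in> nb u \<Longrightarrow> branch w u (g w) 1 (E w)"
    by (rule vertex_solution_unit[OF assms(1)]) (rule that)
  have "\<exists>g E. branch w u g 1 E" using *(2)[OF assms(2)] by auto
  then show ?thesis unfolding ratio_def by (rule someI_ex)
qed

text \<open>
  This is where the vanishing of the Wronskian enters: it is applied to the branch that starts at \<open>w\<close>.
\<close>

lemma ratio_unique:
  assumes "u \<in> support" "w \<in> nb u" "branch w u g \<alpha> E"
  shows "g = ratio u w * \<alpha>"
proof -
  obtain F where "branch w u (ratio u w) 1 F" using ratio_branch_ex[OF assms(1,2)] by blast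
  moreover have "w \<in> V" "u \<in> nb w" using assms nb_in_V nb_sym support_in_V by auto
  ultimately have "g * 1 = ratio u w * \<alpha>" using branch_values_proportional assms(3) by blast
  then show ?thesis by simp
qed

lemma ratio_sum:
  assumes "u \<in> support"
  shows "(\<Sum>w\<in>nb u. a u w * ratio u w) = b u"
proof -
  obtain g E where *: "(\<Sum>w\<in>nb u. a u w * g w) = b u" "\<And>w. w \<in> nb u \<Longrightarrow> branch w u (g w) 1 (E w)"
    by (rule vertex_solution_unit[OF assms(1)]) (rule that)
  have "(\<Sum>w\<in>nb u. a u w * ratio u w) = (\<Sum>w\<in>nb u. a u w * g w)"
    using ratio_unique[OF assms _ *(2)] by (intro sum.cong) auto
  with * show ?thesis by simp
qed

text \<open>
  Dropping one branch of a full solution at \<open>u\<close> leaves the branch rooted at \<open>u\<close> and seen from \<open>v\<close>.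
\<close>

lemma branch_from_support:
  assumes "u \<in> support" "v \<in> nb u"
  shows "\<exists>E. branch u v 1 (ratio u v) E"
proof -
  define F where "F w = (SOME E. branch w u (ratio u w) 1 E)" for w
  have F: "branch w u (ratio u w) 1 (F w)" if "w \<in> nb u" for w
    unfolding F_def by (rule someI_ex[OF ratio_branch_ex[OF assms(1) that]])
  have fin: "finite (nb u)" using finite_nb support_in_V assms by blast
  have "branch u v 1 (ratio u v) (1 + (\<Sum>w\<in>nb u - {v}. F w))"
  proof (rule branch.step[of _ u "ratio u" v _ _ F])
    show "0 \<le> 1 + (\<Sum>w\<in>nb u - {v}. F w)"
      by (intro add_nonneg_nonneg sum_nonneg) (auto intro: branch_nonneg[OF F])
    show "(\<Sum>w\<in>nb u - {v}. a u w * ratio u w) + a u v * ratio u v = b u * 1"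
      using ratio_sum[OF assms(1)] sum.remove[OF fin assms(2), of "\<lambda>w. a u w * ratio u w"]
      by (simp add: add.commute)
  qed (use F in auto)
  then show ?thesis by blast
qed

lemma ratio_inverse:
  assumes "u \<in> support" "w \<in> support" "w \<in> nb u"
  shows "ratio w u * ratio u w = 1"
  using branch_from_support[OF assms(1,3)] ratio_unique[OF assms(2) nb_sym[OF assms(3)]] by metis

lemma glue_branches:
  assumes "u \<in> V" "v \<in> nb u" "branch u v \<alpha> \<beta> E" "branch v u \<beta> \<alpha> F"
  shows "vertex_solution u \<alpha>"
proof -
  obtain g E' where *: "(\<Sum>w\<in>nb u - {v}. a u w * g w) + a u v * \<beta> = b u * \<alpha>"
      "(cmod \<alpha>)\<^sup>2 + (\<Sum>w\<in>nb u - {v}. E' w) \<le> E"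
      "\<And>w. w \<in> nb u - {v} \<Longrightarrow> branch w u (g w) \<alpha> (E' w)"
    by (rule branchE[OF assms(3)]) (rule that)
  have "(\<Sum>w\<in>nb u. a u w * (g(v := \<beta>)) w) = a u v * \<beta> + (\<Sum>w\<in>nb u - {v}. a u w * (g(v := \<beta>)) w)"
    using sum.remove[OF finite_nb[OF assms(1)] assms(2), of "\<lambda>w. a u w * (g(v := \<beta>)) w"] by simp
  also have "(\<Sum>w\<in>nb u - {v}. a u w * (g(v := \<beta>)) w) = (\<Sum>w\<in>nb u - {v}. a u w * g w)"
    by (intro sum.cong) auto
  finally have "(\<Sum>w\<in>nb u. a u w * (g(v := \<beta>)) w) = b u * \<alpha>" using *(1) by (simp only: add.commute)
  moreover have "branch w u ((g(v := \<beta>)) w) \<alpha> ((E'(v := F)) w)" if "w \<in> nb u" for w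
    using *(3)[of w] assms(4) that by auto
  ultimately show ?thesis unfolding vertex_solution_def by blast
qed

text \<open>
  If the ratio were nonzero, the solution at \<open>u\<close> would also be one at \<open>w\<close> with a nonzero value there.
\<close>

lemma ratio_outside_support:
  assumes "u \<in> support" "w \<in> nb u" "w \<notin> support"
  shows "ratio u w = 0"
proof (rule ccontr)
  assume "ratio u w \<noteq> 0"
  moreover have "w \<in> V" using assms nb_in_V support_in_V by blast
  moreover have "vertex_solution w (ratio u w)"
    using glue_branches[OF \<open>w \<in> V\<close> nb_sym[OF assms(2)]] ratio_branch_ex[OF assms(1,2)]
      branch_from_support[OF assms(1,2)] by blast
  ultimately show False using assms(3) by (auto simp: support_def)
qed

lemma branch_cost_set:
  assumes "u \<in> support" "w \<in> nb u"
  shows "{E. branch w u (ratio u w) 1 E} \<noteq> {}"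
    "bdd_below {E. branch w u (ratio u w) 1 E}"
  using ratio_branch_ex[OF assms] by (auto simp: bdd_below_def intro: branch_nonneg)

lemma branch_cost_le: "u \<in> support \<Longrightarrow> w \<in> nb u \<Longrightarrow> branch w u (ratio u w) 1 E \<Longrightarrow> branch_cost u w \<le> E"
  unfolding branch_cost_def using branch_cost_set by (intro cInf_lower) auto

lemma branch_cost_lower_bound:
  assumes "u \<in> support" "w \<in> nb u" "0 \<le> c"
    and "\<And>E. branch w u (ratio u w) 1 E \<Longrightarrow> k \<le> c * E"
  shows "k \<le> c * branch_cost u w"
proof (cases "c = 0")
  case True
  then show ?thesis using assms(4) ratio_branch_ex[OF assms(1,2)] by auto
next
  case False
  with assms have c: "0 < c" by simp
  have "k / c \<le> branch_cost u w"
    unfolding branch_cost_def using branch_cost_set[OF assms(1,2)] assms(4) c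
    by (intro cInf_greatest) (auto simp: divide_simps mult.commute)
  then show ?thesis using c by (simp add: divide_simps mult.commute)
qed

lemma branch_cost_nonneg: "u \<in> support \<Longrightarrow> w \<in> nb u \<Longrightarrow> 0 \<le> branch_cost u w"
  using branch_cost_lower_bound[of u w 1 0] branch_nonneg by auto

lemma total_minus_cost:
  assumes "u \<in> support" "v \<in> nb u"
  shows "total_cost u - branch_cost u v = 1 + (\<Sum>w\<in>nb u - {v}. branch_cost u w)"
  using sum.remove[OF finite_nb[OF support_in_V[OF assms(1)]] assms(2), of "branch_cost u"]
  by (simp add: total_cost_def)

lemma total_minus_cost_ge_1:
  assumes "u \<in> support" "v \<in> nb u"
  shows "1 \<le> total_cost u - branch_cost u v"
  proof -
  have "0 \<le> (\<Sum>w\<in>nb u - {v}. branch_cost u w)" by (rule sum_nonneg) (use assms branch_cost_nonneg in auto)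
  then show ?thesis unfolding total_minus_cost[OF assms] by simp
qed

lemma total_cost_ge_1: "u \<in> support \<Longrightarrow> 1 \<le> total_cost u"
  unfolding total_cost_def by (simp add: sum_nonneg branch_cost_nonneg)

text \<open>
  Every branch that leaves \<open>u\<close> has the prescribed ratios, so it costs at least what remains
  of \<open>total_cost u\<close> after the direction of \<open>v\<close> is removed, up to scaling.
\<close>

lemma branch_energy_lower:
  assumes "u \<in> support" "v \<in> nb u" "branch u v \<alpha> \<beta> E"
  shows "(cmod \<alpha>)\<^sup>2 * (total_cost u - branch_cost u v) \<le> E"
proof (cases "\<alpha> = 0")
  case True
  then show ?thesis using branch_nonneg[OF assms(3)] by simp
next
  case False
  define F where "F = (cmod (1 / \<alpha>))\<^sup>2 * E"
  have B: "branch u v 1 (\<beta> / \<alpha>) F"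
    using branch_scale[OF assms(3), of "1 / \<alpha>"] False by (simp add: F_def)
  obtain g E' where *: "(\<Sum>w\<in>nb u - {v}. a u w * g w) + a u v * (\<beta> / \<alpha>) = b u * 1"
      "(cmod 1)\<^sup>2 + (\<Sum>w\<in>nb u - {v}. E' w) \<le> F"
      "\<And>w. w \<in> nb u - {v} \<Longrightarrow> branch w u (g w) 1 (E' w)"
    by (rule branchE[OF B]) (rule that)
  have "branch_cost u w \<le> E' w" if "w \<in> nb u - {v}" for w
    using ratio_unique[OF assms(1) _ *(3)[OF that]] *(3)[OF that] that
    by (intro branch_cost_le[OF assms(1)]) auto
  then have "(\<Sum>w\<in>nb u - {v}. branch_cost u w) \<le> (\<Sum>w\<in>nb u - {v}. E' w)" by (rule sum_mono)
  then have "total_cost u - branch_cost u v \<le> F" using *(2) by (simp add: total_minus_cost[OF assms(1,2)])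
  then have "(cmod \<alpha>)\<^sup>2 * (total_cost u - branch_cost u v) \<le> (cmod \<alpha>)\<^sup>2 * F" by (rule mult_left_mono) simp
  also have "\<dots> = E" using False by (simp add: F_def norm_divide power_divide)
  finally show ?thesis .
qed

text \<open>
  The fraction of the energy of the optimal solution at \<open>u\<close> which lies beyond the edge to \<open>w\<close>.
\<close>

definition share :: "'v \<Rightarrow> 'v \<Rightarrow> real" where
  "share u w = branch_cost u w / total_cost u"

text \<open>
  The missing part is the energy at \<open>u\<close> itself. This strict inequality is what drives the final contradiction.
\<close>

lemma sum_share:
  assumes "u \<in> support"
  shows "(\<Sum>w\<in>nb u. share u w) < 1"
proof -
  have "(\<Sum>w\<in>nb u. share u w) = (total_cost u - 1) / total_cost u"
    by (simp add: share_def sum_divide_distrib[symmetric] total_cost_def)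
  also have "\<dots> < 1" using total_cost_ge_1[OF assms] by simp
  finally show ?thesis .
qed

text \<open>
  When both ends of an edge lie in the support, the optimal solutions at the two ends are proportional,
  and the edge separates the tree into the parts whose energies are counted by the two shares.
  The two lower bounds on the costs already give the inequality, without exhibiting minimisers.
\<close>

lemma share_inside:
  assumes "u \<in> support" "w \<in> support" "w \<in> nb u"
  shows "1 \<le> share u w + share w u"
proof -
  have uw: "u \<in> nb w" using assms nb_sym by blast
  define r where "r = (cmod (ratio u w))\<^sup>2"
  have r: "r * (cmod (ratio w u))\<^sup>2 = 1"
    using ratio_inverse[OF assms] unfolding r_def
    by (metis mult.commute norm_mult norm_one one_power2 power_mult_distrib)
  then have r0: "0 < r" by (metis r_def mult_zero_left zero_less_power2 zero_neq_one power_zero_numeral norm_ge_zero)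
  have "r * (total_cost w - branch_cost w u) \<le> 1 * branch_cost u w"
    unfolding r_def by (rule branch_cost_lower_bound[OF assms(1,3)]) (use branch_energy_lower[OF assms(2) uw] in auto)
  then have 1: "r * total_cost w \<le> branch_cost u w + r * branch_cost w u" by (simp add: algebra_simps)
  have "(cmod (ratio w u))\<^sup>2 * (total_cost u - branch_cost u w) \<le> 1 * branch_cost w u"
    by (rule branch_cost_lower_bound[OF assms(2) uw]) (use branch_energy_lower[OF assms(1,3)] in auto)
  then have "r * ((cmod (ratio w u))\<^sup>2 * (total_cost u - branch_cost u w)) \<le> r * branch_cost w u"
    using r0 by (intro mult_left_mono) auto
  then have 2: "total_cost u \<le> branch_cost u w + r * branch_cost w u"
    using r by (simp add: mult.assoc[symmetric])
  have t: "0 < total_cost u" "0 < total_cost w" using total_cost_ge_1 assms by force+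
  have c: "0 \<le> branch_cost u w" "0 \<le> branch_cost w u" using branch_cost_nonneg assms uw by auto
  \<comment> \<open>Both quantities are the energy of the same solution, normalised at \<open>u\<close>; comparing with their
    maximum avoids proving that they agree.\<close>
  define m where "m = max (total_cost u) (r * total_cost w)"
  have m: "0 < m" "total_cost u \<le> m" "r * total_cost w \<le> m" "m \<le> branch_cost u w + r * branch_cost w u"
    using t 1 2 by (auto simp: m_def)
  have "1 \<le> (branch_cost u w + r * branch_cost w u) / m" using m by simp
  also have "\<dots> = branch_cost u w / m + (r * branch_cost w u) / m" by (rule add_divide_distrib)
  also have "\<dots> \<le> branch_cost u w / total_cost u + (r * branch_cost w u) / (r * total_cost w)"
    using m t r0 c by (intro add_mono divide_left_mono) auto
  also have "\<dots> = share u w + share w u" using r0 by (simp add: share_def)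
  finally show ?thesis .
qed

text \<open>
  A branch with value \<open>0\<close> at \<open>v\<close> and \<open>g\<close> at \<open>w\<close> violates the equation at \<open>v\<close> by a
  multiple of \<open>g\<close> only, and the branch through \<open>u\<close> can compensate this. The result is a
  solution on the whole tree, so \<open>g \<noteq> 0\<close> would put \<open>w\<close> into the support.
\<close>

lemma branch_value_outside_support:
  assumes "v \<in> V" "v \<notin> support" "u \<in> support" "u \<in> nb v" "w \<in> nb v" "w \<noteq> u" "w \<notin> support"
    and B: "branch w v g 0 E"
  shows "g = 0"
proof (rule ccontr)
  assume g: "g \<noteq> 0"
  have w: "w \<in> V" using assms nb_in_V by blast
  have vu: "v \<in> nb u" using assms nb_sym by blast
  have a0: "a v u \<noteq> 0" using a_nonzero assms by blast
  define c where "c = - a v w * g / a v u"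
  have "ratio u v = 0" using ratio_outside_support assms vu by blast
  then obtain F where "branch u v 1 0 F" using branch_from_support[OF assms(3) vu] by auto
  from branch_scale[OF this, of c] obtain F where F: "branch u v c 0 F" by auto
  \<comment> \<open>The compensating branch through \<open>u\<close>; all other branches at \<open>v\<close> are zero.\<close>
  define h where "h x = (if x = u then c else 0)" for x
  define H where "H x = (if x = u then F else 0)" for x
  have br: "branch x v (h x) 0 (H x)" for x
    using F branch_zero by (auto simp: h_def H_def)
  have "branch v w 0 g (\<Sum>x\<in>nb v - {w}. H x)"
  proof (rule branch.step[of _ v h w _ _ H])
    show "0 \<le> (\<Sum>x\<in>nb v - {w}. H x)" by (rule sum_nonneg) (use br branch_nonneg in blast)
    have "(\<Sum>x\<in>nb v - {w}. a v x * h x) = (\<Sum>x\<in>nb v - {w}. if x = u then a v u * c else 0)"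
      by (rule sum.cong) (auto simp: h_def)
    also have "\<dots> = a v u * c" using finite_nb[OF assms(1)] assms by (simp add: sum.delta)
    finally show "(\<Sum>x\<in>nb v - {w}. a v x * h x) + a v w * g = b v * 0" using a0 by (simp add: c_def)
  qed (use br in auto)
  then have "vertex_solution w g" using glue_branches[OF w nb_sym[OF assms(5)] B] by blast
  then show False using assms(7) w g by (auto simp: support_def)
qed

text \<open>
  Let \<open>v\<close> be outside the support. A solution with value \<open>1\<close> at \<open>u\<close> and \<open>0\<close> at \<open>v\<close> must
  balance the contribution of \<open>u\<close> at \<open>v\<close> by the other neighbours of \<open>v\<close> in the support.
  If \<open>m w\<close> is the cost of a branch rooted at \<open>w\<close> with value \<open>1\<close>, the cheapest way costs
  \<open>(cmod (a v u))\<^sup>2 / (Y - y u)\<close>, where \<open>y w = (cmod (a v w))\<^sup>2 / m w\<close> and \<open>Y\<close> is the sum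
  of the \<open>y w\<close>, by the Cauchy-Schwarz inequality. Hence the share that \<open>u\<close> sends across \<open>v\<close> is at
  least \<open>y u / Y\<close>, and these fractions add up to \<open>1\<close>.
\<close>

lemma share_outside:
  assumes "v \<in> V" "v \<notin> support" "nb v \<inter> support \<noteq> {}"
  shows "1 \<le> (\<Sum>u\<in>nb v \<inter> support. share u v)"
proof -
  let ?N = "nb v \<inter> support"
  have finN: "finite ?N" using finite_nb[OF assms(1)] by auto
  define m where "m u = total_cost u - branch_cost u v" for u
  have m1: "1 \<le> m u" if "u \<in> ?N" for u
    unfolding m_def using total_minus_cost_ge_1 that nb_sym by blast
  have m0: "0 < m u" if "u \<in> ?N" for u using m1[OF that] by simp
  define y where "y u = (cmod (a v u))\<^sup>2 / m u" for u
  define Y where "Y = sum y ?N"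
  have y0: "0 < y u" if "u \<in> ?N" for u
    unfolding y_def using m0[OF that] a_nonzero[OF assms(1), of u] that by simp
  have Y0: "0 < Y" unfolding Y_def using y0 assms(3) finN by (intro sum_pos) auto
  have "y u / Y \<le> share u v" if u: "u \<in> ?N" for u
  proof -
    have vu: "v \<in> nb u" and us: "u \<in> support" using u nb_sym by auto
    have r0: "ratio u v = 0" using ratio_outside_support us vu assms by blast
    have Yy: "Y - y u = sum y (?N - {u})"
      using sum.remove[OF finN u, of y] by (simp add: Y_def)
    have Yy0: "0 \<le> Y - y u" unfolding Yy by (rule sum_nonneg) (use y0 in force)
    have "(cmod (a v u))\<^sup>2 \<le> (Y - y u) * branch_cost u v"
    proof (rule branch_cost_lower_bound[OF us vu Yy0])
      fix E assume "branch v u (ratio u v) 1 E"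
      then have B: "branch v u 0 1 E" by (simp add: r0)
      obtain g F where g: "(\<Sum>w\<in>nb v - {u}. a v w * g w) + a v u * 1 = b v * 0"
        "(cmod 0)\<^sup>2 + (\<Sum>w\<in>nb v - {u}. F w) \<le> E"
        "\<And>w. w \<in> nb v - {u} \<Longrightarrow> branch w v (g w) 0 (F w)"
        by (rule branchE[OF B]) (rule that)
      have sub: "?N - {u} \<subseteq> nb v - {u}" by auto
      have fin: "finite (nb v - {u})" using finite_nb[OF assms(1)] by simp
      have "(\<Sum>w\<in>?N - {u}. a v w * g w) = (\<Sum>w\<in>nb v - {u}. a v w * g w)"
      proof (rule sum.mono_neutral_left[OF fin sub], rule ballI)
        fix w assume w: "w \<in> nb v - {u} - (?N - {u})"
        then have "g w = 0"
          using branch_value_outside_support[OF assms(1,2) us _ _ _ _ g(3)[of w]] u by auto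
        then show "a v w * g w = 0" by simp
      qed
      then have "a v u = - (\<Sum>w\<in>?N - {u}. a v w * g w)" using g(1) by (simp add: add_eq_0_iff)
      then have "cmod (a v u) \<le> (\<Sum>w\<in>?N - {u}. cmod (a v w) * cmod (g w))"
        by (metis (no_types, lifting) norm_minus_cancel norm_mult norm_sum sum.cong)
      also have "\<dots> = (\<Sum>w\<in>?N - {u}. cmod (a v w) / sqrt (m w) * (sqrt (m w) * cmod (g w)))"
        using m0 by (intro sum.cong refl) (simp add: less_imp_neq[symmetric])
      finally have "(cmod (a v u))\<^sup>2 \<le> (\<Sum>w\<in>?N - {u}. cmod (a v w) / sqrt (m w) * (sqrt (m w) * cmod (g w)))\<^sup>2"
        by (rule power_mono) simp
      also have "\<dots> \<le> (\<Sum>w\<in>?N - {u}. (cmod (a v w) / sqrt (m w))\<^sup>2) * (\<Sum>w\<in>?N - {u}. (sqrt (m w) * cmod (g w))\<^sup>2)"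
        by (rule Cauchy_Schwarz_ineq_sum)
      also have "(\<Sum>w\<in>?N - {u}. (cmod (a v w) / sqrt (m w))\<^sup>2) = Y - y u"
        unfolding Yy using m0 by (intro sum.cong) (auto simp: y_def power_divide less_imp_le)
      also have "(\<Sum>w\<in>?N - {u}. (sqrt (m w) * cmod (g w))\<^sup>2) \<le> (\<Sum>w\<in>?N - {u}. F w)"
      proof (rule sum_mono)
        fix w assume w: "w \<in> ?N - {u}"
        then have "(sqrt (m w) * cmod (g w))\<^sup>2 = (cmod (g w))\<^sup>2 * m w"
          using m0[of w] by (auto simp: power_mult_distrib less_imp_le)
        also have "\<dots> \<le> F w"
          unfolding m_def using w nb_sym by (intro branch_energy_lower[OF _ _ g(3)]) auto
        finally show "(sqrt (m w) * cmod (g w))\<^sup>2 \<le> F w" .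
      qed
      also have "\<dots> \<le> (\<Sum>w\<in>nb v - {u}. F w)"
        by (rule sum_mono2[OF fin sub]) (use g(3) branch_nonneg in blast)
      also have "\<dots> \<le> E" using g(2) by simp
      finally show "(cmod (a v u))\<^sup>2 \<le> (Y - y u) * E" using Yy0 by (simp add: mult_left_mono)
    qed
    then have "y u * m u \<le> (Y - y u) * branch_cost u v" using m0[OF u] by (simp add: y_def)
    then have "y u * total_cost u \<le> Y * branch_cost u v" by (simp add: m_def algebra_simps)
    then show ?thesis unfolding share_def using Y0 total_cost_ge_1[OF us] by (simp add: divide_simps mult.commute)
  qed
  then have "(\<Sum>u\<in>?N. y u / Y) \<le> (\<Sum>u\<in>?N. share u v)" by (rule sum_mono)
  moreover have "(\<Sum>u\<in>?N. y u / Y) = 1" using Y0 by (simp add: sum_divide_distrib[symmetric] Y_def)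
  ultimately show ?thesis by simp
qed

text \<open>
  Double counting over the finite graph. Sum \<open>share u w - 1 / d\<close> over the vertices \<open>u\<close> of the support and
  all their neighbours \<open>w\<close>. Vertex by vertex the sum is negative, because there are \<open>d\<close> neighbours
  and the shares add up to less than \<open>1\<close>. Edge by edge it is not: an edge inside the support
  contributes at least \<open>1 - 2 / d\<close>, which is nonnegative as \<open>d \<ge> 2\<close>, and a vertex outside the support
  collects at least \<open>1\<close> and loses at most \<open>d\<close> times \<open>1 / d\<close>.
\<close>

lemma support_empty: "support = {}"
proof (rule ccontr)
  assume ne: "support \<noteq> {}"
  have fin: "finite support" using finite_V by (auto simp: support_def)
  define h where "h u w = share u w - 1 / d" for u w
  have d0: "0 < real d" using d_ge_2 by simp
  have upper: "(\<Sum>u\<in>support. \<Sum>w\<in>nb u. h u w) < 0"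
  proof -
    have "(\<Sum>w\<in>nb u. h u w) < 0" if "u \<in> support" for u
      using sum_share[OF that] card_nb[OF support_in_V[OF that]] d0
      by (simp add: h_def sum_subtractf)
    then show ?thesis using ne fin by (metis (no_types, lifting) sum_strict_mono sum.neutral_const)
  qed
  have inner: "0 \<le> (\<Sum>u\<in>support. \<Sum>w\<in>{w \<in> support. w \<in> nb u}. h u w)" (is "0 \<le> ?X")
  proof -
    have "?X = (\<Sum>w\<in>support. \<Sum>u\<in>{u \<in> support. w \<in> nb u}. h u w)"
      by (rule sum.swap_restrict[OF fin fin])
    also have "\<dots> = (\<Sum>w\<in>support. \<Sum>u\<in>{u \<in> support. u \<in> nb w}. h u w)"
      by (intro sum.cong refl) (auto intro: nb_sym)
    finally have "2 * ?X = (\<Sum>u\<in>support. \<Sum>w\<in>{w \<in> support. w \<in> nb u}. h u w + h w u)"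
      by (simp add: sum.distrib)
    moreover have "0 \<le> h u w + h w u" if "u \<in> support" "w \<in> support" "w \<in> nb u" for u w
    proof -
      have "2 / real d \<le> 1" using d_ge_2 by simp
      with share_inside[OF that] show ?thesis by (simp add: h_def)
    qed
    then have "0 \<le> (\<Sum>u\<in>support. \<Sum>w\<in>{w \<in> support. w \<in> nb u}. h u w + h w u)"
      by (intro sum_nonneg) auto
    ultimately show ?thesis by linarith
  qed
  have outer: "0 \<le> (\<Sum>u\<in>support. \<Sum>v\<in>{v \<in> V - support. v \<in> nb u}. h u v)" (is "0 \<le> ?X")
  proof -
    have "?X = (\<Sum>v\<in>V - support. \<Sum>u\<in>{u \<in> support. v \<in> nb u}. h u v)"
      using finite_V by (intro sum.swap_restrict[OF fin]) auto
    also have "0 \<le> \<dots>"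
    proof (rule sum_nonneg)
      fix v assume v: "v \<in> V - support"
      have N: "{u \<in> support. v \<in> nb u} = nb v \<inter> support" by (auto intro: nb_sym)
      show "0 \<le> (\<Sum>u\<in>{u \<in> support. v \<in> nb u}. h u v)"
      proof (cases "nb v \<inter> support = {}")
        case True
        then show ?thesis unfolding N by simp
      next
        case False
        have "card (nb v \<inter> support) \<le> d"
          using v card_nb finite_nb by (metis Diff_iff card_mono inf_le1)
        then have "(\<Sum>u\<in>nb v \<inter> support. 1 / real d) \<le> 1" using d0 by (simp add: divide_simps)
        then show ?thesis unfolding N h_def sum_subtractf using share_outside[OF _ _ False] v by simp
      qed
    qed
    finally show ?thesis .
  qed
  have "(\<Sum>w\<in>nb u. h u w) = (\<Sum>w\<in>{w \<in> support. w \<in> nb u}. h u w) + (\<Sum>v\<in>{v \<in> V - support. v \<in> nb u}. h u v)"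
    if "u \<in> support" for u
  proof -
    have "nb u = {w \<in> support. w \<in> nb u} \<union> {v \<in> V - support. v \<in> nb u}"
      using nb_in_V support_in_V that by blast
    then show ?thesis
      using sum.union_disjoint[of "{w \<in> support. w \<in> nb u}" "{v \<in> V - support. v \<in> nb u}" "h u"] fin finite_V
      by auto
  qed
  then have "(\<Sum>u\<in>support. \<Sum>w\<in>nb u. h u w) = (\<Sum>u\<in>support. \<Sum>w\<in>{w \<in> support. w \<in> nb u}. h u w)
      + (\<Sum>u\<in>support. \<Sum>v\<in>{v \<in> V - support. v \<in> nb u}. h u v)"
    by (simp add: sum.distrib)
  with upper inner outer show False by linarith
qed

lemma vertex_solution_zero: "u \<in> V \<Longrightarrow> vertex_solution u \<alpha> \<Longrightarrow> \<alpha> = 0"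
  using support_empty by (auto simp: support_def)

text \<open>
  The passage from an actual covering to branches. The numbers \<open>En x y\<close> bound the energy beyond
  \<open>x\<close> as seen from \<open>y\<close>; the values and energies upstairs form a set of tuples that is closed
  under the rule of \<open>branch\<close>, since the covering map is a bijection on neighbours.
\<close>

lemma lifted_solution_zero:
  fixes \<Xi> :: "'w \<Rightarrow> 'v" and nbT :: "'w \<Rightarrow> 'w set" and \<phi> :: "'w \<Rightarrow> complex" and En :: "'w \<Rightarrow> 'w \<Rightarrow> real"
  assumes V: "\<And>x. x \<in> VT \<Longrightarrow> \<Xi> x \<in> V" and nbV: "\<And>x. x \<in> VT \<Longrightarrow> nbT x \<subseteq> VT"
    and sym: "\<And>x y. y \<in> nbT x \<Longrightarrow> x \<in> nbT y"
    and bij: "\<And>x. x \<in> VT \<Longrightarrow> bij_betw \<Xi> (nbT x) (nb (\<Xi> x))"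
    and eq: "\<And>x. x \<in> VT \<Longrightarrow> (\<Sum>y\<in>nbT x. a (\<Xi> x) (\<Xi> y) * \<phi> y) = b (\<Xi> x) * \<phi> x"
    and En0: "\<And>x y. 0 \<le> En x y"
    and En: "\<And>x y. x \<in> VT \<Longrightarrow> y \<in> nbT x \<Longrightarrow> (cmod (\<phi> x))\<^sup>2 + (\<Sum>w\<in>nbT x - {y}. En w x) \<le> En x y"
    and x: "x \<in> VT"
  shows "\<phi> x = 0"
proof -
  define inv where "inv x = inv_into (nbT x) \<Xi>" for x
  have inv: "inv x (\<Xi> y) = y" if "x \<in> VT" "y \<in> nbT x" for x y
    unfolding inv_def using bij[OF that(1)] that(2) by (auto simp: bij_betw_def)
  have inv_in: "inv x w \<in> nbT x" "\<Xi> (inv x w) = w" if "x \<in> VT" "w \<in> nb (\<Xi> x)" for x w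
    unfolding inv_def using bij[OF that(1)] that(2)
    by (auto simp: bij_betw_def inv_into_into f_inv_into_f)
  have br: "branch (\<Xi> x) (\<Xi> y) (\<phi> x) (\<phi> y) (En x y)" if "x \<in> VT" "y \<in> nbT x" for x y
  proof (rule branch_coinduct[of "\<lambda>u v \<alpha> \<beta> E. \<exists>x y. x \<in> VT \<and> y \<in> nbT x \<and> u = \<Xi> x \<and> v = \<Xi> y \<and>
      \<alpha> = \<phi> x \<and> \<beta> = \<phi> y \<and> E = En x y"])
    fix u v \<alpha> \<beta> E
    assume "\<exists>x y. x \<in> VT \<and> y \<in> nbT x \<and> u = \<Xi> x \<and> v = \<Xi> y \<and> \<alpha> = \<phi> x \<and> \<beta> = \<phi> y \<and> E = En x y"
    then obtain x y where x: "x \<in> VT" and y: "y \<in> nbT x"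
      and eqs: "u = \<Xi> x" "v = \<Xi> y" "\<alpha> = \<phi> x" "\<beta> = \<phi> y" "E = En x y" by (elim exE conjE)
    have fin: "finite (nbT x)" using bij[OF x] finite_nb[OF V[OF x]] bij_betw_finite by blast
    have bij': "bij_betw \<Xi> (nbT x - {y}) (nb u - {v})"
      using bij[OF x] y unfolding eqs bij_betw_def by (auto simp: inj_on_def)
    have "(\<Sum>w\<in>nb u - {v}. a u w * \<phi> (inv x w)) = (\<Sum>w\<in>nbT x - {y}. a u (\<Xi> w) * \<phi> (inv x (\<Xi> w)))"
      by (rule sum.reindex_bij_betw[OF bij', symmetric])
    also have "\<dots> = (\<Sum>w\<in>nbT x - {y}. a u (\<Xi> w) * \<phi> w)"
      using inv[OF x] by (intro sum.cong) auto
    also have "\<dots> + a u v * \<beta> = (\<Sum>w\<in>nbT x. a u (\<Xi> w) * \<phi> w)"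
      using sum.remove[OF fin y, of "\<lambda>w. a u (\<Xi> w) * \<phi> w"] by (simp add: eqs add.commute)
    also have "\<dots> = b u * \<alpha>" using eq[OF x] by (simp add: eqs)
    finally have 1: "(\<Sum>w\<in>nb u - {v}. a u w * \<phi> (inv x w)) + a u v * \<beta> = b u * \<alpha>" .
    have "(\<Sum>w\<in>nb u - {v}. En (inv x w) x) = (\<Sum>w\<in>nbT x - {y}. En (inv x (\<Xi> w)) x)"
      by (rule sum.reindex_bij_betw[OF bij', symmetric])
    also have "\<dots> = (\<Sum>w\<in>nbT x - {y}. En w x)"
      using inv[OF x] by (intro sum.cong) auto
    finally have 2: "(cmod \<alpha>)\<^sup>2 + (\<Sum>w\<in>nb u - {v}. En (inv x w) x) \<le> E"
      using En[OF x y] by (simp add: eqs)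
    have 3: "\<exists>x' y'. x' \<in> VT \<and> y' \<in> nbT x' \<and> w = \<Xi> x' \<and> u = \<Xi> y' \<and>
        \<phi> (inv x w) = \<phi> x' \<and> \<alpha> = \<phi> y' \<and> En (inv x w) x = En x' y'" if "w \<in> nb u - {v}" for w
    proof (intro exI conjI)
      have w: "w \<in> nb (\<Xi> x)" using that eqs by simp
      show "inv x w \<in> VT" using inv_in[OF x w] nbV[OF x] by blast
      show "x \<in> nbT (inv x w)" using inv_in[OF x w] sym by blast
      show "w = \<Xi> (inv x w)" using inv_in[OF x w] by simp
    qed (use eqs in auto)
    show "\<exists>g E'. 0 \<le> E \<and> (\<Sum>w\<in>nb u - {v}. a u w * g w) + a u v * \<beta> = b u * \<alpha> \<and>
        (cmod \<alpha>)\<^sup>2 + (\<Sum>w\<in>nb u - {v}. E' w) \<le> E \<and>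
        (\<forall>w\<in>nb u - {v}. \<exists>x y. x \<in> VT \<and> y \<in> nbT x \<and> w = \<Xi> x \<and> u = \<Xi> y \<and>
          g w = \<phi> x \<and> \<alpha> = \<phi> y \<and> E' w = En x y)"
      by (rule exI[of _ "\<lambda>w. \<phi> (inv x w)"], rule exI[of _ "\<lambda>w. En (inv x w) x"],
          intro conjI ballI 1 2 3) (use eqs En0 in auto)
  qed (use that in blast)
  have "vertex_solution (\<Xi> x) (\<phi> x)"
    unfolding vertex_solution_def
  proof (intro exI conjI ballI)
    have "(\<Sum>w\<in>nb (\<Xi> x). a (\<Xi> x) w * \<phi> (inv x w)) = (\<Sum>w\<in>nbT x. a (\<Xi> x) (\<Xi> w) * \<phi> (inv x (\<Xi> w)))"
      by (rule sum.reindex_bij_betw[OF bij[OF x], symmetric])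
    also have "\<dots> = (\<Sum>w\<in>nbT x. a (\<Xi> x) (\<Xi> w) * \<phi> w)"
      using inv[OF x] by (intro sum.cong) auto
    finally show "(\<Sum>w\<in>nb (\<Xi> x). a (\<Xi> x) w * \<phi> (inv x w)) = b (\<Xi> x) * \<phi> x" using eq[OF x] by simp
    fix w assume w: "w \<in> nb (\<Xi> x)"
    show "branch w (\<Xi> x) (\<phi> (inv x w)) (\<phi> x) (En (inv x w) x)"
      using br[of "inv x w" x] inv_in[OF x w] nbV[OF x] sym by auto
  qed
  then show ?thesis using vertex_solution_zero V[OF x] by blast
qed

end

section \<open>Branches of a tree and square-summability at its vertices\<close>

definition reach_avoiding :: "('v, 'x) metric_graph_scheme \<Rightarrow> 'v \<Rightarrow> 'v \<Rightarrow> 'v \<Rightarrow> bool" where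
  "reach_avoiding G u = (\<lambda>x y. adjacent G x y \<and> x \<noteq> u \<and> y \<noteq> u)\<^sup>*\<^sup>*"

lemma adjacent_sym: "adjacent G x y \<longleftrightarrow> adjacent G y x"
  by (auto simp: adjacent_def)

lemma adjacent_irrefl: "metric_graph G \<Longrightarrow> \<not> adjacent G x x"
  by (auto simp: adjacent_def metric_graph_def)

lemma reach_avoiding_sym: "reach_avoiding G u x y \<Longrightarrow> reach_avoiding G u y x"
  unfolding reach_avoiding_def
  by (rule sympD[OF symp_rtranclp]) (auto simp: symp_def adjacent_sym)

lemma reach_avoiding_trans: "reach_avoiding G u x y \<Longrightarrow> reach_avoiding G u y z \<Longrightarrow> reach_avoiding G u x z"
  unfolding reach_avoiding_def by (rule rtranclp_trans)

lemma reach_avoiding_neq: "reach_avoiding G u x y \<Longrightarrow> x \<noteq> u \<Longrightarrow> y \<noteq> u"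
  unfolding reach_avoiding_def by (induction rule: rtranclp_induct) auto

text \<open>
  Besides the usual path without repetitions, the statement records that its vertices are reachable; for
  \<open>reach_avoiding\<close> this shows that the removed vertex is not on the path.
\<close>

lemma distinct_path_exists:
  assumes "R\<^sup>*\<^sup>* x y"
  shows "\<exists>p. p \<noteq> [] \<and> hd p = x \<and> last p = y \<and> distinct p \<and> successively R p \<and> (\<forall>q\<in>set p. R\<^sup>*\<^sup>* x q)"
  using assms
proof (induction rule: converse_rtranclp_induct)
  case base
  show ?case by (rule exI[of _ "[y]"]) auto
next
  case (step x x')
  then obtain p where p: "p \<noteq> []" "hd p = x'" "last p = y" "distinct p" "successively R p" "\<forall>q\<in>set p. R\<^sup>*\<^sup>* x' q"
    by blast
  have reach: "\<forall>q\<in>set p. R\<^sup>*\<^sup>* x q" using p(6) step(1) by (meson converse_rtranclp_into_rtranclp)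
  show ?case
  proof (cases "x \<in> set p")
    case True
    then obtain p1 p2 where "p = p1 @ x # p2" by (meson split_list)
    then show ?thesis using p reach
      by (intro exI[of _ "x # p2"]) (auto simp: successively_append_iff)
  next
    case False
    then show ?thesis using p reach step(1)
      by (intro exI[of _ "x # p"]) (auto simp: successively_Cons)
  qed
qed

text \<open>
  Otherwise a simple path from \<open>x\<close> to \<open>w\<close> that avoids \<open>u\<close> closes up to a cycle through \<open>u\<close>.
\<close>

lemma tree_separation:
  assumes mg: "metric_graph G" and tree: "\<nexists>p. is_cycle G p"
    and adj: "adjacent G u x" "adjacent G u w" "x \<noteq> w"
  shows "\<not> reach_avoiding G u x w"
proof
  assume R: "reach_avoiding G u x w"
  let ?R = "\<lambda>x y. adjacent G x y \<and> x \<noteq> u \<and> y \<noteq> u"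
  obtain p where p: "p \<noteq> []" "hd p = x" "last p = w" "distinct p" "successively ?R p" "\<forall>q\<in>set p. ?R\<^sup>*\<^sup>* x q"
    using distinct_path_exists[OF R[unfolded reach_avoiding_def]] by blast
  have xu: "x \<noteq> u" using adj(1) adjacent_irrefl[OF mg] by blast
  have up: "u \<notin> set p" using p(6) reach_avoiding_neq[OF _ xu] unfolding reach_avoiding_def by blast
  have len: "2 \<le> length p"
  proof (rule ccontr)
    assume "\<not> 2 \<le> length p"
    moreover have "0 < length p" using p(1) by simp
    ultimately have "length p = 1" by linarith
    then have "hd p = last p" by (auto simp: length_Suc_conv)
    then show False using p adj by simp
  qed
  have step: "adjacent G (p ! i) (p ! Suc i)" if "Suc i < length p" for i
    using p(5) that successively_nth[of ?R p i] by blast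
  have "is_cycle G (u # p)"
    unfolding is_cycle_def
  proof (intro conjI allI impI)
    show "3 \<le> length (u # p)" using len by simp
    show "distinct (u # p)" using up p(4) by simp
    fix i assume i: "i < length (u # p)"
    show "adjacent G ((u # p) ! i) ((u # p) ! (Suc i mod length (u # p)))"
    proof (cases i)
      case 0
      then show ?thesis using p(1,2) adj(1) len by (simp add: hd_conv_nth)
    next
      case (Suc j)
      show ?thesis
      proof (cases "Suc j = length p")
        case True
        then have "p ! j = w" using p(1,3) by (metis last_conv_nth diff_Suc_1)
        then show ?thesis using Suc True[symmetric] adj(2) adjacent_sym[of G u w] by simp
      next
        case False
        then have "Suc j < length p" using i Suc by simp
        then show ?thesis using step[of j] Suc by simp
      qed
    qed
  qed
  then show False using tree by blast
qed

lemma reach_avoiding_step: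
  assumes mg: "metric_graph G" and tree: "\<nexists>p. is_cycle G p"
    and adj: "adjacent G u x" "adjacent G u w" "x \<noteq> w" and R: "reach_avoiding G u x y"
  shows "reach_avoiding G w u y"
proof -
  have uw: "u \<noteq> w" using adj adjacent_irrefl[OF mg] by blast
  show ?thesis
    using R unfolding reach_avoiding_def
  proof (induction rule: rtranclp_induct)
    case base
    show ?case using adj uw by (intro r_into_rtranclp) auto
  next
    case (step y z)
    have "y \<noteq> w" "z \<noteq> w"
      using tree_separation[OF mg tree adj] step(1,2) unfolding reach_avoiding_def
      by (auto dest: rtranclp.rtrancl_into_rtrancl)
    then show ?case using step by (auto intro: rtranclp.rtrancl_into_rtrancl)
  qed
qed

text \<open>
  The branch at \<open>u\<close> seen from \<open>w\<close> contains \<open>u\<close> and, disjointly, the branches at the other neighbours of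
  \<open>u\<close>; disjointness is \<open>tree_separation\<close>.
\<close>

lemma tree_branch_energy:
  fixes h :: "'v \<Rightarrow> real"
  assumes mg: "metric_graph G" and tree: "\<nexists>p. is_cycle G p"
    and u: "u \<in> verts G" and w: "adjacent G u w"
    and h0: "\<And>x. 0 \<le> h x" and sm: "h summable_on UNIV"
  shows "h u + (\<Sum>x\<in>neighbours G u - {w}. infsum h {y. reach_avoiding G u x y}) \<le> infsum h {y. reach_avoiding G w u y}"
proof -
  let ?N = "neighbours G u - {w}"
  let ?B = "\<lambda>x. {y. reach_avoiding G u x y}"
  have sm': "h summable_on A" for A using sm by (rule summable_on_subset_banach) simp
  have fin: "finite ?N" using mg u by (simp add: metric_graph_def)
  have N: "adjacent G u x" "x \<noteq> w" if "x \<in> ?N" for x using that by (auto simp: neighbours_def)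
  have disj: "?B x \<inter> ?B x' = {}" if "x \<in> ?N" "x' \<in> ?N" "x \<noteq> x'" for x x'
  proof (rule ccontr)
    assume "?B x \<inter> ?B x' \<noteq> {}"
    then obtain y where y: "reach_avoiding G u x y" "reach_avoiding G u x' y" by blast
    have "reach_avoiding G u x x'" by (rule reach_avoiding_trans[OF y(1) reach_avoiding_sym[OF y(2)]])
    with tree_separation[OF mg tree N(1)[OF that(1)] N(1)[OF that(2)] that(3)] show False by (rule notE)
  qed
  have unot: "u \<notin> (\<Union>x\<in>?N. ?B x)"
  proof
    assume "u \<in> (\<Union>x\<in>?N. ?B x)"
    then obtain x where x: "x \<in> ?N" and R: "reach_avoiding G u x u" by blast
    have "x \<noteq> u" using N(1)[OF x] adjacent_irrefl[OF mg] by metis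
    with reach_avoiding_neq[OF R] show False by simp
  qed
  have "(h has_sum (\<Sum>x\<in>?N. infsum h (?B x))) (\<Union>x\<in>?N. ?B x)"
    by (rule sum_has_sum[OF fin]) (use disj sm' in auto)
  then have "h u + (\<Sum>x\<in>?N. infsum h (?B x)) = infsum h (insert u (\<Union>x\<in>?N. ?B x))"
    using infsum_insert[OF sm' unot] by (simp add: infsumI)
  also have "\<dots> \<le> infsum h {y. reach_avoiding G w u y}"
  proof (rule infsum_mono2)
    show "insert u (\<Union>x\<in>?N. ?B x) \<subseteq> {y. reach_avoiding G w u y}"
    proof (intro insert_subsetI UN_least subsetI CollectI)
      show "reach_avoiding G w u u" by (simp add: reach_avoiding_def)
      show "reach_avoiding G w u y" if "x \<in> ?N" "y \<in> ?B x" for x y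
        using reach_avoiding_step[OF mg tree N(1)[OF that(1)] w N(2)[OF that(1)]] that(2) by simp
    qed
  qed (use sm' h0 in auto)
  finally show ?thesis .
qed

text \<open>
  An infinite family indexed by vertices is controlled by one indexed by edges: choosing one edge for each
  vertex that is a first endpoint, and one for each vertex that is a second endpoint, makes the
  comparison injective.
\<close>

lemma summable_on_endpoints:
  fixes h :: "'v \<Rightarrow> real" and H :: "'v \<times> 'v \<Rightarrow> real"
  assumes H: "H summable_on E" and h0: "\<And>x. 0 \<le> h x"
    and le: "\<And>e. e \<in> E \<Longrightarrow> h (fst e) \<le> C * H e" "\<And>e. e \<in> E \<Longrightarrow> h (snd e) \<le> C * H e"
  shows "h summable_on (fst ` E \<union> snd ` E)"
proof -
  have CH: "(\<lambda>e. C * H e) summable_on E" using H by (rule summable_on_cmult_right)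
  have image: "h summable_on A" if "A \<subseteq> p ` E" "\<And>e. e \<in> E \<Longrightarrow> h (p e) \<le> C * H e" for A p
  proof -
    obtain U where U: "U \<subseteq> E" "inj_on p U" "A = p ` U" using \<open>A \<subseteq> p ` E\<close> unfolding subset_image_inj by blast
    have "(\<lambda>e. C * H e) summable_on U" using CH U(1) by (rule summable_on_subset_banach)
    then have "(\<lambda>e. h (p e)) summable_on U"
      by (rule summable_on_comparison_test) (use that(2) U(1) h0 in auto)
    then show ?thesis using summable_on_reindex[OF U(2), of h] U(3) by (simp add: o_def)
  qed
  have "h summable_on fst ` E" "h summable_on (snd ` E - fst ` E)"
    using image[of _ fst] image[of _ snd] le by auto
  then have "h summable_on (fst ` E \<union> (snd ` E - fst ` E))" by (rule summable_on_Un_disjoint) auto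
  then show ?thesis by simp
qed


lemma quantum_graph_D:
  assumes "quantum_graph G"
  shows "metric_graph G" "e \<in> edges G \<Longrightarrow> continuous_on {0..len G e} (pot G e)"
    "v \<in> verts G \<Longrightarrow> alpha G v \<noteq> -\<infinity>"
  using assms by (auto simp: quantum_graph_def)

lemma metric_graph_D:
  assumes "metric_graph G"
  shows "(u, v) \<in> edges G \<Longrightarrow> u \<in> verts G" "(u, v) \<in> edges G \<Longrightarrow> v \<in> verts G"
    "(u, v) \<in> edges G \<Longrightarrow> (v, u) \<notin> edges G" "u \<in> verts G \<Longrightarrow> finite (neighbours G u)"
    "e \<in> edges G \<Longrightarrow> 0 < len G e" "neighbours G u \<subseteq> verts G"
proof -
  show "e \<in> edges G \<Longrightarrow> 0 < len G e"
    using assms unfolding metric_graph_def by (meson less_le_trans)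
qed (use assms in \<open>auto simp: metric_graph_def neighbours_def adjacent_def\<close>)

text \<open>
  Since an edge is stored in exactly one orientation, the incident edges of \<open>x\<close> correspond to its
  neighbours.
\<close>

lemma sum_over_incident_edges:
  fixes P Q :: "'v \<times> 'v \<Rightarrow> complex"
  assumes mg: "metric_graph G" and x: "x \<in> verts G"
  shows "(\<Sum>e | e \<in> edges G \<and> fst e = x. P e) + (\<Sum>e | e \<in> edges G \<and> snd e = x. Q e)
      = (\<Sum>y\<in>neighbours G x. if (x, y) \<in> edges G then P (x, y) else Q (y, x))"
proof -
  let ?O = "{y. (x, y) \<in> edges G}" and ?I = "{y. (y, x) \<in> edges G}"
  have N: "neighbours G x = ?O \<union> ?I" by (auto simp: neighbours_def adjacent_def)
  have fin: "finite ?O" "finite ?I" using metric_graph_D(4)[OF mg x] unfolding N by auto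
  have disj: "?O \<inter> ?I = {}" using metric_graph_D(3)[OF mg] by auto
  have "(\<Sum>e | e \<in> edges G \<and> fst e = x. P e) = (\<Sum>y\<in>?O. P (x, y))"
    by (rule sum.reindex_bij_witness[of _ "\<lambda>y. (x, y)" snd]) auto
  moreover have "(\<Sum>e | e \<in> edges G \<and> snd e = x. Q e) = (\<Sum>y\<in>?I. Q (y, x))"
    by (rule sum.reindex_bij_witness[of _ "\<lambda>y. (y, x)" fst]) auto
  moreover have "(\<Sum>y\<in>neighbours G x. if (x, y) \<in> edges G then P (x, y) else Q (y, x))
      = (\<Sum>y\<in>?O. P (x, y)) + (\<Sum>y\<in>?I. Q (y, x))"
    unfolding N sum.union_disjoint[OF fin disj]
    by (intro arg_cong2[of _ _ _ _ "(+)"] sum.cong) (use metric_graph_D(3)[OF mg] in auto)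
  ultimately show ?thesis by simp
qed

section \<open>The differential equation on an edge\<close>

definition solves :: "real \<Rightarrow> (real \<Rightarrow> complex) \<Rightarrow> (real \<Rightarrow> complex) \<Rightarrow> (real \<Rightarrow> complex) \<Rightarrow> bool" where
  "solves l q f f1 \<longleftrightarrow> (\<forall>x\<in>{0..l}. (f has_vector_derivative f1 x) (at x within {0..l}) \<and>
     (f1 has_vector_derivative q x * f x) (at x within {0..l}))"

lemma solves_continuous:
  assumes "solves l q f f1"
  shows "continuous_on {0..l} f" "continuous_on {0..l} f1"
  unfolding continuous_on_eq_continuous_within
  using assms[unfolded solves_def] has_vector_derivative_continuous by blast+

lemma solves_lincomb:
  assumes "solves l q f f1" "solves l q g g1"
  shows "solves l q (\<lambda>x. a * f x + b * g x) (\<lambda>x. a * f1 x + b * g1 x)"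
  unfolding solves_def
proof (intro ballI conjI)
  fix x assume x: "x \<in> {0..l}"
  show "((\<lambda>x. a * f x + b * g x) has_vector_derivative a * f1 x + b * g1 x) (at x within {0..l})"
    using assms x unfolding solves_def
    by (intro has_vector_derivative_add has_vector_derivative_mult_right) auto
  have "((\<lambda>x. a * f1 x + b * g1 x) has_vector_derivative a * (q x * f x) + b * (q x * g x)) (at x within {0..l})"
    using assms x unfolding solves_def
    by (intro has_vector_derivative_add has_vector_derivative_mult_right) auto
  then show "((\<lambda>x. a * f1 x + b * g1 x) has_vector_derivative q x * (a * f x + b * g x)) (at x within {0..l})"
    by (simp add: algebra_simps)
qed

text \<open>
  Picard's theorem for a linear equation on a compact interval, obtained in one step from the Banach fixed point theorem:
  the weight \<open>exp (- L * t)\<close> with \<open>L\<close> at least twice the bound on \<open>A\<close> turns the integral operator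
  into a contraction with factor \<open>1/2\<close> on the whole interval.
\<close>

lemma linear_ode_integral_solution:
  fixes A :: "real \<Rightarrow> 'a::banach \<Rightarrow> 'a"
  assumes l: "0 \<le> l"
    and lin: "\<And>t. t \<in> {0..l} \<Longrightarrow> linear (A t)"
    and M: "\<And>t y. t \<in> {0..l} \<Longrightarrow> norm (A t y) \<le> M * norm y"
    and cont: "\<And>Y. continuous_on {0..l} Y \<Longrightarrow> continuous_on {0..l} (\<lambda>t. A t (Y t))"
  shows "\<exists>Y. continuous_on {0..l} Y \<and> (\<forall>x\<in>{0..l}. Y x = Y0 + integral {0..x} (\<lambda>t. A t (Y t)))"
proof -
  define L where "L = 2 * (\<bar>M\<bar> + 1)"
  have L: "0 < L" by (simp add: L_def)
  \<comment> \<open>The complete space at hand consists of bounded continuous functions on the whole line, so functions are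
    extended from the interval by composition with the retraction \<open>c\<close>.\<close>
  define c where "c x = max 0 (min x l)" for x :: real
  have c: "c x \<in> {0..l}" for x using l by (auto simp: c_def)
  have cid: "c x = x" if "x \<in> {0..l}" for x using that by (auto simp: c_def)
  have ccont: "continuous_on UNIV c" unfolding c_def by (intro continuous_intros)
  define F where "F \<phi> t = exp (L * t) *\<^sub>R A t (apply_bcontfun \<phi> t)" for \<phi> :: "real \<Rightarrow>\<^sub>C 'a" and t
  have Fcont: "continuous_on {0..l} (F \<phi>)" for \<phi>
    unfolding F_def
  proof (rule continuous_on_scaleR)
    show "continuous_on {0..l} (\<lambda>t. exp (L * t))" by (intro continuous_intros)
    show "continuous_on {0..l} (\<lambda>t. A t (apply_bcontfun \<phi> t))"
      by (rule cont) (rule continuous_on_apply_bcontfun)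
  qed
  define g where "g \<phi> x = exp (- L * x) *\<^sub>R (Y0 + integral {0..x} (F \<phi>))" for \<phi> x
  have gcont: "continuous_on {0..l} (g \<phi>)" for \<phi>
    unfolding g_def by (intro continuous_intros indefinite_integral_continuous_1 integrable_continuous_interval Fcont)
  define G where "G \<phi> = Bcontfun (\<lambda>x. g \<phi> (c x))" for \<phi>
  have "(\<lambda>x. g \<phi> (c x)) \<in> bcontfun" for \<phi>
  proof -
    have "bounded (g \<phi> ` {0..l})"
      by (intro compact_imp_bounded compact_continuous_image gcont) auto
    then obtain K where K: "\<And>x. x \<in> {0..l} \<Longrightarrow> norm (g \<phi> x) \<le> K" unfolding bounded_iff by blast
    show ?thesis
    proof (rule bcontfun_normI)
      show "continuous_on UNIV (\<lambda>x. g \<phi> (c x))"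
        by (rule continuous_on_compose2[OF gcont ccont]) (use c in auto)
      show "norm (g \<phi> (c x)) \<le> K" for x using K c by blast
    qed
  qed
  then have G: "apply_bcontfun (G \<phi>) x = g \<phi> (c x)" for \<phi> x
    unfolding G_def by (simp add: Bcontfun_inverse)
  have contr: "dist (G \<phi>) (G \<psi>) \<le> 1/2 * dist \<phi> \<psi>" for \<phi> \<psi>
  proof (rule dist_bound)
    fix x0
    define x where "x = c x0"
    have x: "x \<in> {0..l}" using c by (simp add: x_def)
    let ?D = "dist \<phi> \<psi>"
    have sub: "{0..x} \<subseteq> {0..l}" using x by auto
    have int: "F \<phi> integrable_on {0..x}" for \<phi>
      by (intro integrable_continuous_interval continuous_on_subset[OF Fcont sub])
    have ft: "((\<lambda>t. exp (L * t) / L) has_vector_derivative exp (L * t)) (at t within {0..x})" for t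
      unfolding has_real_derivative_iff_has_vector_derivative[symmetric]
      using L by (auto intro!: derivative_eq_intros)
    have "((\<lambda>t. exp (L * t)) has_integral exp (L * x) / L - exp (L * 0) / L) {0..x}"
      by (rule fundamental_theorem_of_calculus[OF _ ft]) (use x in auto)
    then have ex: "((\<lambda>t. M' * exp (L * t)) has_integral M' * (exp (L * x) / L - 1 / L)) {0..x}" for M'
      using has_integral_mult_right[of "\<lambda>t. exp (L * t)" _ _ M'] by simp
    have "norm (integral {0..x} (\<lambda>t. F \<phi> t - F \<psi> t)) \<le> integral {0..x} (\<lambda>t. (\<bar>M\<bar> * ?D) * exp (L * t))"
    proof (rule integral_norm_bound_integral)
      show "(\<lambda>t. F \<phi> t - F \<psi> t) integrable_on {0..x}" by (intro integrable_diff int)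
      show "(\<lambda>t. \<bar>M\<bar> * ?D * exp (L * t)) integrable_on {0..x}" using ex by blast
      fix t assume "t \<in> {0..x}"
      then have t: "t \<in> {0..l}" using sub by blast
      have "F \<phi> t - F \<psi> t = exp (L * t) *\<^sub>R A t (apply_bcontfun \<phi> t - apply_bcontfun \<psi> t)"
        using linear_diff[OF lin[OF t]] by (simp add: F_def scaleR_diff_right)
      then have "norm (F \<phi> t - F \<psi> t) = exp (L * t) * norm (A t (apply_bcontfun \<phi> t - apply_bcontfun \<psi> t))"
        by simp
      also have "\<dots> \<le> exp (L * t) * (M * dist (apply_bcontfun \<phi> t) (apply_bcontfun \<psi> t))"
        using M[OF t] by (simp add: dist_norm)
      also have "\<dots> \<le> exp (L * t) * (\<bar>M\<bar> * ?D)"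
        by (intro mult_left_mono mult_mono dist_bounded) auto
      finally show "norm (F \<phi> t - F \<psi> t) \<le> \<bar>M\<bar> * ?D * exp (L * t)" by (simp add: algebra_simps)
    qed
    also have "\<dots> = \<bar>M\<bar> * ?D * (exp (L * x) / L - 1 / L)" using ex by (rule integral_unique)
    also have "\<dots> \<le> \<bar>M\<bar> * ?D * (exp (L * x) / L)" using L by (intro mult_left_mono) auto
    finally have *: "norm (integral {0..x} (F \<phi>) - integral {0..x} (F \<psi>)) \<le> \<bar>M\<bar> * ?D * (exp (L * x) / L)"
      by (simp add: integral_diff int)
    have "dist (g \<phi> x) (g \<psi> x) = exp (- L * x) * norm (integral {0..x} (F \<phi>) - integral {0..x} (F \<psi>))"
      unfolding g_def dist_norm scaleR_diff_right[symmetric] by simp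
    also have "\<dots> \<le> exp (- L * x) * (\<bar>M\<bar> * ?D * (exp (L * x) / L))"
      using * by (intro mult_left_mono) auto
    also have "\<dots> = exp (- L * x) * exp (L * x) * (\<bar>M\<bar> / L * ?D)" by (simp add: mult_ac)
    also have "\<dots> = \<bar>M\<bar> / L * ?D" by (simp add: exp_add[symmetric])
    also have "\<dots> \<le> 1/2 * ?D" by (intro mult_right_mono) (auto simp: L_def divide_simps)
    finally show "dist (apply_bcontfun (G \<phi>) x0) (apply_bcontfun (G \<psi>) x0) \<le> 1/2 * ?D"
      unfolding G x_def .
  qed
  obtain \<phi> where \<phi>: "G \<phi> = \<phi>"
    using banach_fix_type[of "1/2" G] contr by auto
  define Y where "Y t = exp (L * t) *\<^sub>R apply_bcontfun \<phi> t" for t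
  show ?thesis
  proof (intro exI[of _ Y] conjI ballI)
    show "continuous_on {0..l} Y" unfolding Y_def
      by (rule continuous_on_scaleR) (intro continuous_intros, rule continuous_on_apply_bcontfun)
    fix x assume x: "x \<in> {0..l}"
    have "integral {0..x} (F \<phi>) = integral {0..x} (\<lambda>t. A t (Y t))"
      using x by (intro integral_cong) (auto simp: F_def Y_def linear_scale[OF lin])
    moreover have "apply_bcontfun \<phi> x = g \<phi> x" using G[of \<phi> x] cid[OF x] \<phi> by simp
    then have "Y x = Y0 + integral {0..x} (F \<phi>)" by (simp add: Y_def g_def exp_minus)
    ultimately show "Y x = Y0 + integral {0..x} (\<lambda>t. A t (Y t))" by simp
  qed
qed

lemma solves_exists:
  assumes l: "0 \<le> l" and q: "continuous_on {0..l} q"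
  obtains y y1 where "solves l q y y1" "y 0 = \<alpha>" "y1 0 = \<beta>"
proof -
  define A where "A t Y = (snd Y, q t * fst Y)" for t and Y :: "complex \<times> complex"
  have "bounded (q ` {0..l})" by (intro compact_imp_bounded compact_continuous_image q) auto
  then obtain K where K: "\<And>x. x \<in> {0..l} \<Longrightarrow> norm (q x) \<le> K" unfolding bounded_iff by blast
  have K0: "0 \<le> K" using order_trans[OF norm_ge_zero K[of 0]] l by simp
  have lin: "linear (A t)" for t
    unfolding A_def by (rule linearI) (simp_all add: algebra_simps)
  have bound: "norm (A t y) \<le> (1 + K) * norm y" if "t \<in> {0..l}" for t y
  proof -
    have "norm (A t y) \<le> norm (snd y) + norm (q t) * norm (fst y)"
      unfolding A_def using norm_Pair_le[of "snd y" "q t * fst y"] by (simp add: norm_mult)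
    also have "\<dots> \<le> norm y + K * norm y"
      using K[OF that] K0 norm_fst_le[of "fst y" "snd y"] norm_snd_le[of "snd y" "fst y"]
      by (intro add_mono mult_mono) auto
    finally show ?thesis by (simp add: algebra_simps)
  qed
  have cont: "continuous_on {0..l} (\<lambda>t. A t (Y t))" if "continuous_on {0..l} Y" for Y
    unfolding A_def by (intro continuous_intros that q)
  have "\<exists>Y. continuous_on {0..l} Y \<and> (\<forall>x\<in>{0..l}. Y x = (\<alpha>, \<beta>) + integral {0..x} (\<lambda>t. A t (Y t)))"
    by (rule linear_ode_integral_solution[OF l, of A "1 + K"]) (use lin bound cont in blast)+
  then obtain Y where Y: "continuous_on {0..l} Y"
    "\<And>x. x \<in> {0..l} \<Longrightarrow> Y x = (\<alpha>, \<beta>) + integral {0..x} (\<lambda>t. A t (Y t))"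
    by (elim exE conjE) (rule that, assumption, erule bspec, assumption)
  have cA: "continuous_on {0..l} (\<lambda>t. A t (Y t))"
    by (rule cont[OF Y(1)])
  have dY: "(Y has_vector_derivative A x (Y x)) (at x within {0..l})" if x: "x \<in> {0..l}" for x
  proof (rule has_vector_derivative_transform[OF x Y(2)])
    have "((\<lambda>u. (\<alpha>, \<beta>) + integral {0..u} (\<lambda>t. A t (Y t))) has_vector_derivative 0 + A x (Y x)) (at x within {0..l})"
      by (intro has_vector_derivative_add has_vector_derivative_const integral_has_vector_derivative cA x)
    then show "((\<lambda>u. (\<alpha>, \<beta>) + integral {0..u} (\<lambda>t. A t (Y t))) has_vector_derivative A x (Y x)) (at x within {0..l})"
      by simp
  qed
  show thesis
  proof (rule that)
    show "solves l q (\<lambda>x. fst (Y x)) (\<lambda>x. snd (Y x))"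
      unfolding solves_def
    proof (intro ballI conjI)
      fix x assume x: "x \<in> {0..l}"
      show "((\<lambda>x. fst (Y x)) has_vector_derivative snd (Y x)) (at x within {0..l})"
        using bounded_linear.has_vector_derivative[OF bounded_linear_fst dY[OF x]] by (simp add: A_def)
      show "((\<lambda>x. snd (Y x)) has_vector_derivative q x * fst (Y x)) (at x within {0..l})"
        using bounded_linear.has_vector_derivative[OF bounded_linear_snd dY[OF x]] by (simp add: A_def)
    qed
    have "Y 0 = (\<alpha>, \<beta>)" by (subst Y(2)) (use l in auto)
    then show "fst (Y 0) = \<alpha>" "snd (Y 0) = \<beta>" by simp_all
  qed
qed

lemma solves_wronskian:
  assumes "0 \<le> l" "solves l q f f1" "solves l q g g1"
  shows "f l * g1 l - f1 l * g l = f 0 * g1 0 - f1 0 * g 0"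
proof -
  let ?W = "\<lambda>x. f x * g1 x - f1 x * g x"
  have "(?W has_vector_derivative 0) (at x within {0..l})" if x: "x \<in> {0..l}" for x
  proof -
    have "(?W has_vector_derivative (f x * (q x * g x) + f1 x * g1 x) - (f1 x * g1 x + (q x * f x) * g x)) (at x within {0..l})"
      using assms x unfolding solves_def 
      by (intro has_vector_derivative_diff has_vector_derivative_mult) auto
    then show ?thesis by (simp add: algebra_simps)
  qed
  then obtain c where "\<And>x. x \<in> {0..l} \<Longrightarrow> ?W x = c"
    by (rule has_vector_derivative_zero_constant[OF convex_real_interval(5)[of 0 l], of ?W]) (assumption, rule that)
  then show ?thesis using assms(1) by auto
qed

lemma dirichlet_solvableI:
  assumes "solves l (\<lambda>x. complex_of_real (W x) - z) f f1" "f 0 = 0" "f l = 0" "x \<in> {0..l}" "f x \<noteq> 0"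
  shows "dirichlet_solvable l W z"
  unfolding dirichlet_solvable_def
  by (rule exI[of _ f], rule exI[of _ f1], rule exI[of _ "\<lambda>x. (complex_of_real (W x) - z) * f x"])
     (use assms in \<open>auto simp: solves_def algebra_simps\<close>)

text \<open>
  Without Dirichlet solutions a solution is determined by its values at the two ends, so the outgoing
  derivatives are linear functions of these values. The solution \<open>s\<close> with \<open>s 0 = 0\<close>, \<open>s' 0 = 1\<close>
  has \<open>s l \<noteq> 0\<close>, and the coefficient of the value at the opposite end is \<open>1 / s l\<close>.
  It is the same at both ends because the Wronskian of \<open>s\<close> with a second solution is constant.
\<close>

lemma dirichlet_to_neumann:
  assumes l: "0 < l" and W: "continuous_on {0..l} W" and nd: "\<not> dirichlet_solvable l W z"
  obtains A K K' where "A \<noteq> 0"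
    "\<And>f f1. solves l (\<lambda>x. complex_of_real (W x) - z) f f1 \<Longrightarrow> f1 0 = A * f l + K * f 0 \<and> - f1 l = A * f 0 + K' * f l"
proof -
  let ?q = "\<lambda>x. complex_of_real (W x) - z"
  have q: "continuous_on {0..l} ?q" by (intro continuous_intros W)
  obtain s s1 where s: "solves l ?q s s1" "s 0 = 0" "s1 0 = 1"
    using solves_exists[OF _ q] l by (metis less_imp_le)
  obtain c c1 where c: "solves l ?q c c1" "c 0 = 1" "c1 0 = 0"
    using solves_exists[OF _ q] l by (metis less_imp_le)
  have sl: "s l \<noteq> 0"
  proof
    assume "s l = 0"
    then have z: "s x = 0" if "x \<in> {0..l}" for x
      using dirichlet_solvableI[OF s(1,2)] that nd by blast
    have "(s has_vector_derivative s1 0) (at 0 within {0..l})" using s(1) l by (simp add: solves_def)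
    moreover have "(s has_vector_derivative 0) (at 0 within {0..l})"
      by (rule has_vector_derivative_transform[of _ _ _ "\<lambda>_. 0"]) (use z l in auto)
    ultimately have "s1 0 = 0"
      using vector_derivative_unique_within_closed_interval l
      by (metis atLeastAtMost_iff box_real(2) less_eq_real_def)
    with s show False by simp
  qed
  have wr: "c l * s1 l - c1 l * s l = 1"
    using solves_wronskian[OF _ c(1) s(1)] l c s by simp
  show thesis
  proof (rule that[of "1 / s l" "- c l / s l" "- s1 l / s l"])
    show "1 / s l \<noteq> 0" using sl by simp
    fix f f1 assume f: "solves l ?q f f1"
    define m where "m = (f l - f 0 * c l) / s l"
    define h where "h x = 1 * f x + (-1) * (f 0 * c x + m * s x)" for x
    define h1 where "h1 x = 1 * f1 x + (-1) * (f 0 * c1 x + m * s1 x)" for x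
    have h: "solves l ?q h h1"
      unfolding h_def h1_def by (intro solves_lincomb f c s)
    have "h 0 = 0" "h l = 0" using sl c s by (auto simp: h_def m_def)
    then have hz: "h x = 0" if "x \<in> {0..l}" for x using dirichlet_solvableI[OF h] that nd by blast
    have h1z: "h1 x = 0" if x: "x \<in> {0..l}" for x
    proof -
      have "(h has_vector_derivative h1 x) (at x within {0..l})" using h x by (simp add: solves_def)
      moreover have "(h has_vector_derivative 0) (at x within {0..l})"
        by (rule has_vector_derivative_transform[of _ _ _ "\<lambda>_. 0"]) (use hz x in auto)
      ultimately show ?thesis
        using vector_derivative_unique_within_closed_interval l x by (metis box_real(2))
    qed
    have f10: "f1 0 = m" and f1l: "f1 l = f 0 * c1 l + m * s1 l"
      using h1z[of 0] h1z[of l] l c s by (auto simp: h1_def algebra_simps)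
    have m: "m * s l = f l - f 0 * c l" using sl by (simp add: m_def)
    have "- f1 l * s l = f 0 - s1 l * f l"
      using f1l m wr by algebra
    then show "f1 0 = 1 / s l * f l + - c l / s l * f 0 \<and> - f1 l = 1 / s l * f 0 + - s1 l / s l * f l"
      using sl f10 m by (simp add: field_simps)
  qed
qed

text \<open>
  A trace inequality, proved by differentiating \<open>(x - t) / l * (cmod (f x))\<^sup>2\<close>. The parameter \<open>t\<close>
  selects the endpoint: \<open>t = 0\<close> isolates the value at \<open>l\<close> and \<open>t = l\<close> the value at \<open>0\<close>.
\<close>

lemma solution_endpoint_bound:
  assumes l: "0 < l" and f: "solves l q f f1" and t: "t \<in> {0..l}"
  shows "(l - t) / l * (cmod (f l))\<^sup>2 + t / l * (cmod (f 0))\<^sup>2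
      \<le> (1 / l + 1) * integral {0..l} (\<lambda>x. (cmod (f x))\<^sup>2 + (cmod (f1 x))\<^sup>2)"
proof -
  define u where "u x = (x - t) / l * (f x \<bullet> f x)" for x
  define u1 where "u1 x = (x - t) / l * (f x \<bullet> f1 x + f1 x \<bullet> f x) + 1 / l * (f x \<bullet> f x)" for x
  have "(u1 has_integral u l - u 0) {0..l}"
  proof (rule fundamental_theorem_of_calculus)
    fix x assume x: "x \<in> {0..l}"
    have "((\<lambda>x. f x \<bullet> f x) has_vector_derivative f x \<bullet> f1 x + f1 x \<bullet> f x) (at x within {0..l})"
      using f x unfolding solves_def
      by (intro bounded_bilinear.has_vector_derivative[OF bounded_bilinear_inner]) auto
    moreover have "((\<lambda>x. (x - t) / l) has_vector_derivative 1 / l) (at x within {0..l})"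
      unfolding has_real_derivative_iff_has_vector_derivative[symmetric]
      using l by (auto intro!: derivative_eq_intros)
    ultimately show "(u has_vector_derivative u1 x) (at x within {0..l})"
      unfolding u_def u1_def by (rule has_vector_derivative_mult[rotated])
  qed (use l in simp)
  moreover have "(\<lambda>x. (cmod (f x))\<^sup>2 + (cmod (f1 x))\<^sup>2) integrable_on {0..l}"
    by (intro integrable_continuous_interval continuous_intros solves_continuous[OF f])
  then have "((\<lambda>x. (1 / l + 1) * ((cmod (f x))\<^sup>2 + (cmod (f1 x))\<^sup>2)) has_integral
      (1 / l + 1) * integral {0..l} (\<lambda>x. (cmod (f x))\<^sup>2 + (cmod (f1 x))\<^sup>2)) {0..l}"
    by (intro has_integral_mult_right integrable_integral)
  ultimately have "u l - u 0 \<le> (1 / l + 1) * integral {0..l} (\<lambda>x. (cmod (f x))\<^sup>2 + (cmod (f1 x))\<^sup>2)"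
  proof (rule has_integral_le)
    fix x assume x: "x \<in> {0..l}"
    have w: "\<bar>(x - t) / l\<bar> \<le> 1" using x t l by (auto simp: abs_le_iff divide_simps)
    have "f x \<bullet> f1 x + f1 x \<bullet> f x = 2 * (f x \<bullet> f1 x)" by (simp add: inner_commute)
    moreover have "\<bar>f x \<bullet> f1 x\<bar> \<le> cmod (f x) * cmod (f1 x)" by (rule Cauchy_Schwarz_ineq2)
    moreover have "2 * (cmod (f x) * cmod (f1 x)) \<le> (cmod (f x))\<^sup>2 + (cmod (f1 x))\<^sup>2"
      using sum_squares_bound[of "cmod (f x)" "cmod (f1 x)"] by simp
    ultimately have 1: "\<bar>f x \<bullet> f1 x + f1 x \<bullet> f x\<bar> \<le> (cmod (f x))\<^sup>2 + (cmod (f1 x))\<^sup>2" by linarith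
    have "(x - t) / l * (f x \<bullet> f1 x + f1 x \<bullet> f x) \<le> \<bar>(x - t) / l\<bar> * \<bar>f x \<bullet> f1 x + f1 x \<bullet> f x\<bar>"
      by (metis abs_ge_self abs_mult)
    also have "\<dots> \<le> 1 * ((cmod (f x))\<^sup>2 + (cmod (f1 x))\<^sup>2)" using w 1 by (intro mult_mono) auto
    finally have "u1 x \<le> (cmod (f x))\<^sup>2 + (cmod (f1 x))\<^sup>2 + 1 / l * (cmod (f x))\<^sup>2"
      by (simp add: u1_def power2_norm_eq_inner)
    also have "\<dots> \<le> (1 / l + 1) * ((cmod (f x))\<^sup>2 + (cmod (f1 x))\<^sup>2)"
      using l by (simp add: algebra_simps)
    finally show "u1 x \<le> (1 / l + 1) * ((cmod (f x))\<^sup>2 + (cmod (f1 x))\<^sup>2)" .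
  qed
  moreover have "u l - u 0 = (l - t) / l * (cmod (f l))\<^sup>2 + t / l * (cmod (f 0))\<^sup>2"
    using l by (simp add: u_def power2_norm_eq_inner)
  ultimately show ?thesis by simp
qed

lemma L2_on_imp_integrable:
  assumes "L2_on l h"
  shows "integrable (lebesgue_on {0..l}) h"
proof (rule Bochner_Integration.integrable_bound)
  show "integrable (lebesgue_on {0..l}) (\<lambda>x. 1 + (cmod (h x))\<^sup>2)"
    using assms by (intro Bochner_Integration.integrable_add) (auto simp: L2_on_def)
  show "h \<in> borel_measurable (lebesgue_on {0..l})" using assms by (simp add: L2_on_def)
  have "t \<le> 1 + t\<^sup>2" for t :: real
  proof -
    have "2 * t \<le> t\<^sup>2 + 1" using sum_squares_bound[of t 1] by simp
    moreover have "0 \<le> t\<^sup>2" by simp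
    ultimately show ?thesis by linarith
  qed
  then show "AE x in lebesgue_on {0..l}. norm (h x) \<le> norm (1 + (cmod (h x))\<^sup>2)"
    by (simp add: abs_of_nonneg)
qed

lemma H1_deriv_integral:
  assumes "H1_deriv l g h"
  shows "h integrable_on {0..l}" "\<And>x. x \<in> {0..l} \<Longrightarrow> g x = g 0 + integral {0..x} h"
proof -
  have int: "integrable (lebesgue_on {0..l}) h"
    by (rule L2_on_imp_integrable) (rule assms[unfolded H1_deriv_def, THEN conjunct1])
  then show "h integrable_on {0..l}" by (rule integrable_on_lebesgue_on) simp
  fix x assume x: "x \<in> {0..l}"
  have "integrable (lebesgue_on {0..x}) h"
    by (rule Equivalence_Lebesgue_Henstock_Integration.integrable_subinterval[OF int]) (use x in auto)
  then have "(\<integral>t. h t \<partial>lebesgue_on {0..x}) = integral {0..x} h"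
    by (rule lebesgue_integral_eq_integral) simp
  moreover have "g x = g 0 + (\<integral>t. h t \<partial>lebesgue_on {0..x})"
    using assms x unfolding H1_deriv_def by blast
  ultimately show "g x = g 0 + integral {0..x} h" by (simp only:)
qed

lemma H1_deriv_continuous:
  assumes "H1_deriv l g h"
  shows "continuous_on {0..l} g"
proof (rule continuous_on_eq)
  show "continuous_on {0..l} (\<lambda>x. g 0 + integral {0..x} h)"
    by (intro continuous_on_add continuous_on_const indefinite_integral_continuous_1 H1_deriv_integral(1)[OF assms])
  show "g 0 + integral {0..x} h = g x" if "x \<in> {0..l}" for x
    by (rule H1_deriv_integral(2)[OF assms that, symmetric])
qed

text \<open>
  If the weak derivative has a continuous representative, then it is the classical derivative.
\<close>

lemma H1_deriv_has_vector_derivative: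
  assumes "H1_deriv l g h" and k: "continuous_on {0..l} k" and ae: "AE x in lebesgue_on {0..l}. h x = k x"
    and x: "x \<in> {0..l}"
  shows "(g has_vector_derivative k x) (at x within {0..l})"
proof (rule has_vector_derivative_transform[OF x])
  have "AE x in lebesgue. x \<in> {0..l} \<longrightarrow> h x = k x"
    using ae by (subst (asm) AE_restrict_space_iff) auto
  then obtain N where N: "N \<in> null_sets lebesgue" "{x. \<not> (x \<in> {0..l} \<longrightarrow> h x = k x)} \<subseteq> N"
    unfolding eventually_ae_filter by auto
  show "g y = g 0 + integral {0..y} k" if y: "y \<in> {0..l}" for y
  proof -
    have "integral {0..y} h = integral {0..y} k"
      by (rule integral_spike[of N]) (use N y in \<open>auto simp: negligible_iff_null_sets\<close>)
    then show ?thesis using H1_deriv_integral(2)[OF assms(1) y] by (simp only:)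
  qed
  have "((\<lambda>u. g 0 + integral {0..u} k) has_vector_derivative 0 + k x) (at x within {0..l})"
    by (intro has_vector_derivative_add has_vector_derivative_const integral_has_vector_derivative k x)
  then show "((\<lambda>u. g 0 + integral {0..u} k) has_vector_derivative k x) (at x within {0..l})" by simp
qed

text \<open>
  For an eigenfunction, the second derivative is almost everywhere equal to the continuous function
  \<open>(W - z) f\<close>; this is how elements of the Sobolev space become classical solutions.
\<close>

lemma H2_eigenfunction_solves:
  assumes H2: "H2_derivs l f f1 f2" and W: "continuous_on {0..l} W"
    and ae: "AE x in lebesgue_on {0..l}. z * f x = - f2 x + complex_of_real (W x) * f x"
  shows "solves l (\<lambda>x. complex_of_real (W x) - z) f f1"
  unfolding solves_def
proof (intro ballI conjI)
  have H: "H1_deriv l f f1" "H1_deriv l f1 f2" using H2 by (auto simp: H2_derivs_def)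
  fix x assume x: "x \<in> {0..l}"
  show "(f has_vector_derivative f1 x) (at x within {0..l})"
    by (rule H1_deriv_has_vector_derivative[OF H(1) H1_deriv_continuous[OF H(2)] _ x]) simp
  have k: "continuous_on {0..l} (\<lambda>x. (complex_of_real (W x) - z) * f x)"
    by (intro continuous_intros W H1_deriv_continuous[OF H(1)])
  have "AE x in lebesgue_on {0..l}. f2 x = (complex_of_real (W x) - z) * f x"
    using ae by eventually_elim (simp add: algebra_simps)
  then show "(f1 has_vector_derivative (complex_of_real (W x) - z) * f x) (at x within {0..l})"
    by (rule H1_deriv_has_vector_derivative[OF H(2) k _ x])
qed

lemma continuous_cmod_squared_integrable:
  fixes f :: "real \<Rightarrow> complex"
  assumes "continuous_on {0..l} f"
  shows "integrable (lebesgue_on {0..l}) (\<lambda>x. (cmod (f x))\<^sup>2)"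
  by (rule continuous_imp_integrable_real) (intro continuous_intros assms)

lemma H2_endpoint_bound:
  assumes l: "0 < l" and H2: "H2_derivs l f f1 f2" and f: "solves l q f f1"
  shows "(cmod (f 0))\<^sup>2 \<le> (1 / l + 1) * H2_norm_sq l f f1 f2"
    and "(cmod (f l))\<^sup>2 \<le> (1 / l + 1) * H2_norm_sq l f f1 f2"
proof -
  have i: "integrable (lebesgue_on {0..l}) (\<lambda>x. (cmod (f x))\<^sup>2 + (cmod (f1 x))\<^sup>2)"
    by (intro Bochner_Integration.integrable_add continuous_cmod_squared_integrable solves_continuous[OF f])
  have i2: "integrable (lebesgue_on {0..l}) (\<lambda>x. (cmod (f2 x))\<^sup>2)"
    using H2 unfolding H2_derivs_def H1_deriv_def L2_on_def by blast
  have "integral {0..l} (\<lambda>x. (cmod (f x))\<^sup>2 + (cmod (f1 x))\<^sup>2)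
      = (\<integral>x. (cmod (f x))\<^sup>2 + (cmod (f1 x))\<^sup>2 \<partial>lebesgue_on {0..l})"
    by (rule lebesgue_integral_eq_integral[OF i, symmetric]) simp
  also have "\<dots> \<le> H2_norm_sq l f f1 f2"
    unfolding H2_norm_sq_def by (intro integral_mono Bochner_Integration.integrable_add i i2) simp
  finally have *: "(1 / l + 1) * integral {0..l} (\<lambda>x. (cmod (f x))\<^sup>2 + (cmod (f1 x))\<^sup>2) \<le> (1 / l + 1) * H2_norm_sq l f f1 f2"
    using l by (intro mult_left_mono) auto
  show "(cmod (f 0))\<^sup>2 \<le> (1 / l + 1) * H2_norm_sq l f f1 f2"
    using solution_endpoint_bound[OF l f, of l] l * by simp
  show "(cmod (f l))\<^sup>2 \<le> (1 / l + 1) * H2_norm_sq l f f1 f2"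
    using solution_endpoint_bound[OF l f, of 0] l * by simp
qed

text \<open>
  The operator \<open>f'' - m\<^sup>2 f\<close> factors, so \<open>f' - m f\<close> solves a first-order equation. Used with \<open>m\<close> and
  \<open>- m\<close>, this yields the general solution without a uniqueness theorem.
\<close>

lemma constant_coefficient_factor:
  assumes f: "solves l (\<lambda>_. m\<^sup>2) f f1" and x: "x \<in> {0..l}"
  shows "f1 x - m * f x = (f1 0 - m * f 0) * exp (- m * x)"
proof -
  let ?g = "\<lambda>x. (f1 x - m * f x) * exp (m * complex_of_real x)"
  have "(?g has_vector_derivative 0) (at y within {0..l})" if y: "y \<in> {0..l}" for y
  proof -
    have "((\<lambda>x. exp (m * complex_of_real x)) has_vector_derivative m * exp (m * complex_of_real y)) (at y within {0..l})"
      by (rule has_vector_derivative_real_field) (auto intro!: derivative_eq_intros)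
    moreover have "((\<lambda>x. f1 x - m * f x) has_vector_derivative m\<^sup>2 * f y - m * f1 y) (at y within {0..l})"
      using f y unfolding solves_def
      by (intro has_vector_derivative_diff has_vector_derivative_mult_right) auto
    ultimately have "(?g has_vector_derivative (f1 y - m * f y) * (m * exp (m * complex_of_real y))
        + (m\<^sup>2 * f y - m * f1 y) * exp (m * complex_of_real y)) (at y within {0..l})"
      by (rule has_vector_derivative_mult[rotated])
    then show ?thesis by (simp add: algebra_simps power2_eq_square)
  qed
  then obtain c where c: "\<And>x. x \<in> {0..l} \<Longrightarrow> ?g x = c"
    by (rule has_vector_derivative_zero_constant[OF convex_real_interval(5)[of 0 l], of ?g]) (assumption, rule that)
  have "?g x = ?g 0" using c[OF x] c[of 0] x by auto
  then have "(f1 x - m * f x) * (exp (m * x) * exp (- m * x)) = (f1 0 - m * f 0) * exp (- m * x)"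
    by (simp add: mult.assoc[symmetric])
  then show ?thesis by (simp add: exp_add[symmetric])
qed

lemma dirichlet_free_eigenvalue:
  assumes l: "0 < l" and W: "\<And>x. x \<in> {0..l} \<Longrightarrow> W x = 0" and D: "dirichlet_solvable l W z"
  shows "\<exists>n::nat. 1 \<le> n \<and> z = complex_of_real ((real n)\<^sup>2 * pi\<^sup>2 / l\<^sup>2)"
proof -
  define m where "m = csqrt (- z)"
  have m2: "m\<^sup>2 = - z" by (simp add: m_def)
  obtain f f1 f2 x0 where f: "\<forall>x\<in>{0..l}. (f has_vector_derivative f1 x) (at x within {0..l})"
      "\<forall>x\<in>{0..l}. (f1 has_vector_derivative f2 x) (at x within {0..l})"
      "\<forall>x\<in>{0..l}. - f2 x + complex_of_real (W x) * f x = z * f x"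
    and bc: "f 0 = 0" "f l = 0" and x0: "x0 \<in> {0..l}" "f x0 \<noteq> 0"
    using D unfolding dirichlet_solvable_def by blast
  have "f2 x = m\<^sup>2 * f x" if "x \<in> {0..l}" for x
  proof -
    have "- f2 x = z * f x" using f(3) W that by auto
    then have "f2 x = - (z * f x)" by (metis minus_minus)
    then show ?thesis by (simp add: m2)
  qed
  then have s: "solves l (\<lambda>_. m\<^sup>2) f f1" using f(1,2) by (simp add: solves_def)
  then have s': "solves l (\<lambda>_. (- m)\<^sup>2) f f1" by simp
  \<comment> \<open>For \<open>m = 0\<close> this identity is empty, so that case is excluded separately below.\<close>
  have e: "2 * m * f x = f1 0 * (exp (m * x) - exp (- m * x))" if "x \<in> {0..l}" for x
    using constant_coefficient_factor[OF s that] constant_coefficient_factor[OF s' that] bc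
    by (simp add: algebra_simps)
  have m0: "m \<noteq> 0"
  proof
    assume m: "m = 0"
    have d: "f1 x = f1 0" if "x \<in> {0..l}" for x
      using constant_coefficient_factor[OF s that] m by simp
    have "((\<lambda>x. f x - f1 0 * complex_of_real x) has_vector_derivative 0) (at x within {0..l})" if x: "x \<in> {0..l}" for x
    proof -
      have "((\<lambda>x. f1 0 * complex_of_real x) has_vector_derivative f1 0) (at x within {0..l})"
        by (rule has_vector_derivative_real_field) (auto intro!: derivative_eq_intros)
      then have "((\<lambda>x. f x - f1 0 * complex_of_real x) has_vector_derivative f1 x - f1 0) (at x within {0..l})"
        using f(1) x by (intro has_vector_derivative_diff) auto
      then show ?thesis using d[OF x] by simp
    qed
    then obtain c where c: "\<And>x. x \<in> {0..l} \<Longrightarrow> f x - f1 0 * complex_of_real x = c"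
      by (rule has_vector_derivative_zero_constant[OF convex_real_interval(5)[of 0 l], of "\<lambda>x. f x - f1 0 * complex_of_real x"]) (assumption, rule that)
    have "c = 0" using c[of 0] l bc by simp
    then have "f1 0 = 0" using c[of l] l bc by simp
    then show False using c[OF x0(1)] x0(2) \<open>c = 0\<close> by simp
  qed
  have "f1 0 \<noteq> 0" using e[OF x0(1)] x0(2) m0 by auto
  then have "exp (m * l) = exp (- m * l)" using e[of l] l bc by simp
  then obtain n :: int where "m * l = - m * l + (of_int (2 * n) * pi) * \<i>"
    unfolding exp_eq by auto
  then have ml: "m * l = of_int n * pi * \<i>" by (simp add: algebra_simps)
  then have n0: "n \<noteq> 0" using m0 l by auto
  have "m = of_int n * pi * \<i> / l" using ml l by (simp add: field_simps)
  then have "m\<^sup>2 = - ((of_int n)\<^sup>2 * (of_real pi)\<^sup>2 / (of_real l)\<^sup>2)"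
    by (simp add: power_mult_distrib power_divide)
  then have "z = (of_int n)\<^sup>2 * (of_real pi)\<^sup>2 / (of_real l)\<^sup>2" using m2 by simp
  moreover have "((of_int n)\<^sup>2 :: complex) = (of_nat (nat \<bar>n\<bar>))\<^sup>2"
    by (simp add: power2_eq_square of_nat_nat abs_if)
  ultimately have "z = complex_of_real ((real (nat \<bar>n\<bar>))\<^sup>2 * pi\<^sup>2 / l\<^sup>2)" by simp
  moreover have "1 \<le> nat \<bar>n\<bar>" using n0 by simp
  ultimately show ?thesis by blast
qed

section \<open>Eigenfunctions on the universal cover\<close>

text \<open>
  If no edge has a Dirichlet solution at \<open>z\<close>, the Dirichlet-to-Neumann relation turns the vertex conditions
  into a Jacobi equation for the values at the vertices, with coefficients lifted from the finite graph.
  These values are square-summable by the trace inequality, since the edge lengths are bounded below,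
  and hence vanish. But then the eigenfunction itself is a Dirichlet solution on any edge where it does not vanish.
\<close>

lemma eigenvalue_of_cover_imp_dirichlet:
  fixes \<Gamma> :: "'v quantum_graph" and T :: "'w quantum_graph" and \<Xi> :: "'w \<Rightarrow> 'v"
  assumes \<Gamma>: "quantum_graph \<Gamma>" "compact_graph \<Gamma>" "regular_graph d \<Gamma>" "d \<noteq> 1"
    and alpha: "\<forall>v\<in>verts \<Gamma>. alpha \<Gamma> v < \<infinity>"
    and cover: "universal_cover T \<Gamma> \<Xi>"
    and z: "z \<in> point_spectrum T"
  shows "\<exists>e\<in>edges \<Gamma>. dirichlet_solvable (len \<Gamma> e) (pot \<Gamma> e) z"
proof (rule ccontr)
  assume "\<not> ?thesis"
  then have nd: "\<not> dirichlet_solvable (len \<Gamma> e) (pot \<Gamma> e) z" if "e \<in> edges \<Gamma>" for e using that by blast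
  note mg = quantum_graph_D(1)[OF \<Gamma>(1)]
  have T: "quantum_graph T" "\<nexists>p. is_cycle T p"
    and Xi: "\<Xi> ` verts T = verts \<Gamma>" "\<And>x. x \<in> verts T \<Longrightarrow> bij_betw \<Xi> (neighbours T x) (neighbours \<Gamma> (\<Xi> x))"
    and edge: "\<And>e. e \<in> edges T \<Longrightarrow> map_prod \<Xi> \<Xi> e \<in> edges \<Gamma>"
      "\<And>e. e \<in> edges T \<Longrightarrow> len T e = len \<Gamma> (map_prod \<Xi> \<Xi> e)"
      "\<And>e x. e \<in> edges T \<Longrightarrow> x \<in> {0..len T e} \<Longrightarrow> pot T e x = pot \<Gamma> (map_prod \<Xi> \<Xi> e) x"
    and alphaT: "\<And>x. x \<in> verts T \<Longrightarrow> alpha T x = alpha \<Gamma> (\<Xi> x)"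
    using cover by (auto simp: universal_cover_def tree_graph_def covering_map_def)
  note mgT = quantum_graph_D(1)[OF T(1)]
  obtain f f1 f2 e0 x0 where dom: "in_domain T f f1 f2"
    and ae: "\<And>e. e \<in> edges T \<Longrightarrow> AE x in lebesgue_on {0..len T e}.
           z * f e x = - f2 e x + complex_of_real (pot T e x) * f e x"
    and e0: "e0 \<in> edges T" "x0 \<in> {0..len T e0}" "f e0 x0 \<noteq> 0"
    using z unfolding point_spectrum_def schroedinger_op_def by blast
  have H2: "H2_derivs (len T e) (f e) (f1 e) (f2 e)" if "e \<in> edges T" for e
    using dom that by (simp add: in_domain_def)
  have sol: "solves (len T e) (\<lambda>x. complex_of_real (pot T e x) - z) (f e) (f1 e)" if "e \<in> edges T" for e
    by (rule H2_eigenfunction_solves[OF H2[OF that] quantum_graph_D(2)[OF T(1) that] ae[OF that]])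
  have sol\<Gamma>: "solves (len \<Gamma> (map_prod \<Xi> \<Xi> e)) (\<lambda>x. complex_of_real (pot \<Gamma> (map_prod \<Xi> \<Xi> e) x) - z) (f e) (f1 e)"
    if "e \<in> edges T" for e
    using sol[OF that] edge(2,3)[OF that] unfolding solves_def by auto
  define coeffs where "coeffs e A K K' \<longleftrightarrow> A \<noteq> 0 \<and>
      (\<forall>f f1. solves (len \<Gamma> e) (\<lambda>x. complex_of_real (pot \<Gamma> e x) - z) f f1 \<longrightarrow>
        f1 0 = A * f (len \<Gamma> e) + K * f 0 \<and> - f1 (len \<Gamma> e) = A * f 0 + K' * f (len \<Gamma> e))" for e A K K'
  have "\<exists>A K K'. coeffs e A K K'" if e: "e \<in> edges \<Gamma>" for e
    unfolding coeffs_def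
    by (rule dirichlet_to_neumann[OF metric_graph_D(5)[OF mg e] quantum_graph_D(2)[OF \<Gamma>(1) e] nd[OF e]]) blast
  then obtain A K K' where coeffs: "\<And>e. e \<in> edges \<Gamma> \<Longrightarrow> coeffs e (A e) (K e) (K' e)" by metis
  have A0: "A e \<noteq> 0" if "e \<in> edges \<Gamma>" for e using coeffs[OF that] by (simp add: coeffs_def)
  have dtn: "f1 0 = A e * f (len \<Gamma> e) + K e * f 0" "- f1 (len \<Gamma> e) = A e * f 0 + K' e * f (len \<Gamma> e)"
    if "e \<in> edges \<Gamma>" "solves (len \<Gamma> e) (\<lambda>x. complex_of_real (pot \<Gamma> e x) - z) f f1" for e f f1
    using coeffs[OF that(1)] that(2) unfolding coeffs_def by blast+
  \<comment> \<open>The default \<open>0\<close> off the edges makes \<open>a\<close> symmetric on all pairs.\<close>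
  define a where "a u w = (if (u, w) \<in> edges \<Gamma> then A (u, w) else if (w, u) \<in> edges \<Gamma> then A (w, u) else 0)" for u w
  define k where "k u w = (if (u, w) \<in> edges \<Gamma> then K (u, w) else K' (w, u))" for u w
  define b where "b u = complex_of_real (real_of_ereal (alpha \<Gamma> u)) - (\<Sum>w\<in>neighbours \<Gamma> u. k u w)" for u
  obtain u0 v0 where uv0: "(u0, v0) \<in> edges \<Gamma>" using edge(1)[OF e0(1)] by (cases "map_prod \<Xi> \<Xi> e0") auto
  have "d \<noteq> 0"
  proof -
    have "v0 \<in> neighbours \<Gamma> u0" using uv0 by (simp add: neighbours_def adjacent_def)
    moreover have u0: "u0 \<in> verts \<Gamma>" using metric_graph_D(1)[OF mg uv0] .
    ultimately show ?thesis
      using metric_graph_D(4)[OF mg u0] \<Gamma>(3) unfolding regular_graph_def by (metis card_eq_0_iff empty_iff)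
  qed
  interpret regular_jacobi "verts \<Gamma>" "neighbours \<Gamma>" a b d
  proof
    show "finite (verts \<Gamma>)" using \<Gamma>(2) by (simp add: compact_graph_def)
    show "neighbours \<Gamma> v \<subseteq> verts \<Gamma>" for v by (rule metric_graph_D(6)[OF mg])
    show "w \<in> neighbours \<Gamma> v \<Longrightarrow> v \<in> neighbours \<Gamma> w" for v w by (simp add: neighbours_def adjacent_sym)
    show "v \<in> verts \<Gamma> \<Longrightarrow> card (neighbours \<Gamma> v) = d" for v using \<Gamma>(3) by (simp add: regular_graph_def)
    show "2 \<le> d" using \<Gamma>(4) \<open>d \<noteq> 0\<close> by simp
    show "a v w = a w v" for v w using metric_graph_D(3)[OF mg] by (auto simp: a_def)
    show "v \<in> verts \<Gamma> \<Longrightarrow> w \<in> neighbours \<Gamma> v \<Longrightarrow> a v w \<noteq> 0" for v w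
      using A0 by (auto simp: a_def neighbours_def adjacent_def)
  qed
  define vertex_value where "vertex_value x c \<longleftrightarrow> (\<forall>e\<in>edges T. fst e = x \<longrightarrow> f e 0 = c) \<and>
      (\<forall>e\<in>edges T. snd e = x \<longrightarrow> f e (len T e) = c) \<and>
      (\<Sum>e | e \<in> edges T \<and> fst e = x. f1 e 0) + (\<Sum>e | e \<in> edges T \<and> snd e = x. - f1 e (len T e))
      = complex_of_real (real_of_ereal (alpha \<Gamma> (\<Xi> x))) * c" for x c
  have "\<exists>c. vertex_value x c" if x: "x \<in> verts T" for x
  proof -
    have "\<Xi> x \<in> verts \<Gamma>" using Xi(1) x by blast
    then have "alpha T x \<noteq> \<infinity>" using alphaT[OF x] alpha by force
    moreover have "vertex_condition T f f1 x" using dom x unfolding in_domain_def by blast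
    ultimately show ?thesis
      unfolding vertex_condition_def vertex_value_def alphaT[OF x] by (simp only: if_False)
  qed
  then obtain \<phi>' where \<phi>': "\<And>x. x \<in> verts T \<Longrightarrow> vertex_value x (\<phi>' x)" by metis
  \<comment> \<open>Extending by \<open>0\<close> allows summation over the whole type.\<close>
  define \<phi> where "\<phi> x = (if x \<in> verts T then \<phi>' x else 0)" for x
  have \<phi>: "f (x, y) 0 = \<phi> x" "f (x, y) (len T (x, y)) = \<phi> y" if "(x, y) \<in> edges T" for x y
    using \<phi>'[of x] \<phi>'[of y] that metric_graph_D(1,2)[OF mgT that] by (auto simp: \<phi>_def vertex_value_def)
  have flux: "f1 (x, y) 0 = a (\<Xi> x) (\<Xi> y) * \<phi> y + k (\<Xi> x) (\<Xi> y) * \<phi> x"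
      "- f1 (x, y) (len T (x, y)) = a (\<Xi> y) (\<Xi> x) * \<phi> x + k (\<Xi> y) (\<Xi> x) * \<phi> y" if e: "(x, y) \<in> edges T" for x y
  proof -
    have E: "(\<Xi> x, \<Xi> y) \<in> edges \<Gamma>" using edge(1)[OF e] by simp
    then have E': "(\<Xi> y, \<Xi> x) \<notin> edges \<Gamma>" using metric_graph_D(3)[OF mg] by blast
    have l: "len T (x, y) = len \<Gamma> (\<Xi> x, \<Xi> y)" using edge(2)[OF e] by simp
    have D1: "f1 (x, y) 0 = A (\<Xi> x, \<Xi> y) * \<phi> y + K (\<Xi> x, \<Xi> y) * \<phi> x"
      using dtn(1)[OF edge(1)[OF e] sol\<Gamma>[OF e]] \<phi>[OF e] l by simp
    have D2: "- f1 (x, y) (len T (x, y)) = A (\<Xi> x, \<Xi> y) * \<phi> x + K' (\<Xi> x, \<Xi> y) * \<phi> y"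
      using dtn(2)[OF edge(1)[OF e] sol\<Gamma>[OF e]] \<phi>[OF e] l by simp
    show "f1 (x, y) 0 = a (\<Xi> x) (\<Xi> y) * \<phi> y + k (\<Xi> x) (\<Xi> y) * \<phi> x"
      unfolding D1 using E by (simp add: a_def k_def)
    show "- f1 (x, y) (len T (x, y)) = a (\<Xi> y) (\<Xi> x) * \<phi> x + k (\<Xi> y) (\<Xi> x) * \<phi> y"
      unfolding D2 using E E' by (simp add: a_def k_def)
  qed
  have eq: "(\<Sum>y\<in>neighbours T x. a (\<Xi> x) (\<Xi> y) * \<phi> y) = b (\<Xi> x) * \<phi> x" if x: "x \<in> verts T" for x
  proof -
    have "complex_of_real (real_of_ereal (alpha \<Gamma> (\<Xi> x))) * \<phi> x
      = (\<Sum>y\<in>neighbours T x. if (x, y) \<in> edges T then f1 (x, y) 0 else - f1 (y, x) (len T (y, x)))"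
      using \<phi>'[OF x] x unfolding sum_over_incident_edges[OF mgT x] vertex_value_def by (simp add: \<phi>_def)
    also have "\<dots> = (\<Sum>y\<in>neighbours T x. a (\<Xi> x) (\<Xi> y) * \<phi> y + k (\<Xi> x) (\<Xi> y) * \<phi> x)"
      by (intro sum.cong refl) (auto simp: flux neighbours_def adjacent_def)
    also have "\<dots> = (\<Sum>y\<in>neighbours T x. a (\<Xi> x) (\<Xi> y) * \<phi> y) + (\<Sum>y\<in>neighbours T x. k (\<Xi> x) (\<Xi> y)) * \<phi> x"
      by (simp add: sum.distrib sum_distrib_right)
    also have "(\<Sum>y\<in>neighbours T x. k (\<Xi> x) (\<Xi> y)) = (\<Sum>w\<in>neighbours \<Gamma> (\<Xi> x). k (\<Xi> x) w)"
      by (rule sum.reindex_bij_betw[OF Xi(2)[OF x]])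
    finally show ?thesis by (simp add: b_def algebra_simps)
  qed
  define h where "h x = (cmod (\<phi> x))\<^sup>2" for x
  define H where "H e = H2_norm_sq (len T e) (f e) (f1 e) (f2 e)" for e
  obtain c where c: "0 < c" "\<And>e. e \<in> edges T \<Longrightarrow> c \<le> len T e"
    using mgT unfolding metric_graph_def by blast
  have hH: "h (fst e) \<le> (1 / c + 1) * H e" "h (snd e) \<le> (1 / c + 1) * H e" if e: "e \<in> edges T" for e
  proof -
    obtain x y where xy: "e = (x, y)" by fastforce
    note bd = H2_endpoint_bound[OF metric_graph_D(5)[OF mgT e] H2[OF e] sol[OF e]]
    have "0 \<le> H e" unfolding H_def H2_norm_sq_def by (intro Bochner_Integration.integral_nonneg) auto
    moreover have "1 / len T e \<le> 1 / c" using c e by (simp add: frac_le)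
    ultimately have le: "(1 / len T e + 1) * H e \<le> (1 / c + 1) * H e" by (intro mult_right_mono) auto
    show "h (fst e) \<le> (1 / c + 1) * H e" using bd(1) le \<phi>[of x y] e unfolding xy h_def H_def by simp
    show "h (snd e) \<le> (1 / c + 1) * H e" using bd(2) le \<phi>[of x y] e unfolding xy h_def H_def by simp
  qed
  have "H summable_on edges T" using dom unfolding in_domain_def H_def by blast
  then have "h summable_on (fst ` edges T \<union> snd ` edges T)"
    by (rule summable_on_endpoints) (use hH in \<open>auto simp: h_def\<close>)
  moreover have "h x = 0" if "x \<notin> fst ` edges T \<union> snd ` edges T" for x
  proof (cases "x \<in> verts T")
    case True
    have "card (neighbours \<Gamma> (\<Xi> x)) = d" using True Xi(1) card_nb by blast
    then have "neighbours T x \<noteq> {}" using bij_betw_same_card[OF Xi(2)[OF True]] d_ge_2 by auto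
    then show ?thesis using that by (force simp: neighbours_def adjacent_def)
  qed (simp add: h_def \<phi>_def)
  ultimately have sm: "h summable_on UNIV"
    using summable_on_cong_neutral[of "fst ` edges T \<union> snd ` edges T" UNIV h h] by auto
  have \<phi>0: "\<phi> x = 0" if "x \<in> verts T" for x
  proof (rule lifted_solution_zero[of "verts T" \<Xi> "neighbours T" \<phi> "\<lambda>x w. infsum h {y. reach_avoiding T w x y}"])
    show "\<Xi> x \<in> verts \<Gamma>" if "x \<in> verts T" for x using that Xi(1) by blast
    show "neighbours T x \<subseteq> verts T" for x by (rule metric_graph_D(6)[OF mgT])
    show "y \<in> neighbours T x \<Longrightarrow> x \<in> neighbours T y" for x y by (simp add: neighbours_def adjacent_sym)
    show "0 \<le> infsum h {y. reach_avoiding T w x y}" for x w by (rule infsum_nonneg) (simp add: h_def)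
    show "(cmod (\<phi> x))\<^sup>2 + (\<Sum>w\<in>neighbours T x - {y}. infsum h {y. reach_avoiding T x w y})
        \<le> infsum h {ya. reach_avoiding T y x ya}" if "x \<in> verts T" "y \<in> neighbours T x" for x y
      using tree_branch_energy[OF mgT T(2) that(1) _ _ sm, of y] that(2)
      by (simp add: h_def neighbours_def)
  qed (use Xi(2) eq that in auto)
  obtain x y where xy: "e0 = (x, y)" by fastforce
  have "\<phi> x = 0" "\<phi> y = 0" using \<phi>0 metric_graph_D(1,2)[OF mgT] e0(1) xy by auto
  then have "f e0 0 = 0" "f e0 (len T e0) = 0" using \<phi>[of x y] e0(1) xy by auto
  then have "dirichlet_solvable (len \<Gamma> (map_prod \<Xi> \<Xi> e0)) (pot \<Gamma> (map_prod \<Xi> \<Xi> e0)) z"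
    using dirichlet_solvableI[OF sol\<Gamma>[OF e0(1)], of x0] e0 edge(2)[OF e0(1)] by simp
  then show False using nd edge(1)[OF e0(1)] by blast
qed

theorem theorem1p4:
  fixes \<Gamma> :: "'v quantum_graph" and T :: "'w quantum_graph"
    and \<Xi> :: "'w \<Rightarrow> 'v" and d :: nat
  assumes "quantum_graph \<Gamma>"
    and "compact_graph \<Gamma>"
    and "connected_graph \<Gamma>"
    and "regular_graph d \<Gamma>"
    and "d \<noteq> 1"
    and "\<forall>v\<in>verts \<Gamma>. alpha \<Gamma> v < \<infinity>"
    and "universal_cover T \<Gamma> \<Xi>"
  shows "(\<forall>z\<in>point_spectrum T. \<exists>e\<in>edges \<Gamma>. dirichlet_solvable (len \<Gamma> e) (pot \<Gamma> e) z) \<and>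
         ((\<forall>e\<in>edges \<Gamma>. \<forall>x\<in>{0..len \<Gamma> e}. pot \<Gamma> e x = 0) \<longrightarrow>
            point_spectrum T \<subseteq>
              {complex_of_real ((real n)\<^sup>2 * pi\<^sup>2 / (len \<Gamma> e)\<^sup>2) | e n. e \<in> edges \<Gamma> \<and> n \<ge> 1})"
proof (intro conjI ballI impI subsetI)
  show D: "\<exists>e\<in>edges \<Gamma>. dirichlet_solvable (len \<Gamma> e) (pot \<Gamma> e) z" if "z \<in> point_spectrum T" for z
    by (rule eigenvalue_of_cover_imp_dirichlet[OF assms(1,2,4,5,6,7) that])
  fix z assume W: "\<forall>e\<in>edges \<Gamma>. \<forall>x\<in>{0..len \<Gamma> e}. pot \<Gamma> e x = 0" and "z \<in> point_spectrum T"
  then obtain e where e: "e \<in> edges \<Gamma>" "dirichlet_solvable (len \<Gamma> e) (pot \<Gamma> e) z" using D by blast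
  have "\<exists>n::nat. 1 \<le> n \<and> z = complex_of_real ((real n)\<^sup>2 * pi\<^sup>2 / (len \<Gamma> e)\<^sup>2)"
    by (rule dirichlet_free_eigenvalue[OF metric_graph_D(5)[OF quantum_graph_D(1)[OF assms(1)] e(1)] _ e(2)])
      (use W e(1) in blast)
  then show "z \<in> {complex_of_real ((real n)\<^sup>2 * pi\<^sup>2 / (len \<Gamma> e)\<^sup>2) | e n. e \<in> edges \<Gamma> \<and> n \<ge> 1}"
    using e(1) by blast
qed

end
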